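(* Let $G\in\mathcal{G}_1$ be a Lie group with Lie algebra $\mathfrak{g}$, equipped with a left invariant Randers metric $F(x,y)=\sqrt{g(y,y)}+g(X(x),y)$ of Douglas type arising from a left invariant Riemannian metric $g$ and a left invariant vector field $X$. Let $b\in\mathfrak{g}$ and the codimension one commutative ideal $\mathfrak{u}\subset\mathfrak{g}$ be such that $[b,z]=z$ for all $z\in\mathfrak{u}$ and $b$ is orthogonal to $\mathfrak{u}$ with respect to $g$. Write $X=\xi b$ with $\xi\in\mathbb{R}$. Then for every flag $(P,y)$ in $\mathfrak{g}$, writing $y=\eta b+v$ with $\eta\in\mathbb{R}$ and $v\in\mathfrak{u}$, the flag curvature of $F$ is $$K^F(P,y)=\frac{g(y,y)}{F^2}K^g(P)+\frac{1}{4F^4}\left(3\xi^2 g(v,v)^2+4F\xi\eta\, g(v,v)\right),$$ where $F=F(y)$ and $K^g$ is the sectional curvature of $g$. In particular, $$K^F(P,y)=\frac{g(y,y)}{F^2}K^g(P)\quad\text{if } y\in\mathrm{span}\{b\},\qquad K^F(P,y)=\frac{g(y,y)}{F^2}K^g(P)+\frac{3}{4F^4}\xi^2 g(v,v)^2\quad\text{if } y\in\mathfrak{u}.$$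
   Context: $\mathcal{G}_1$ is the family of non-commutative Lie groups $G$ with Lie algebra $\mathfrak{g}$ such that for any $x,y\in\mathfrak{g}$ the bracket $[x,y]$ is a linear combination of $x$ and $y$. It is known (Milnor) that for $G\in\mathcal{G}_1$ there exist a commutative ideal $\mathfrak{u}$ of codimension one and an element $b\in\mathfrak{g}$ with $[b,z]=z$ for every $z\in\mathfrak{u}$; given $g$, $b$ can be chosen orthogonal to $\mathfrak{u}$. With this choice, the Randers metric $F$ is of Douglas type if and only if $X\in\mathrm{span}\{b\}$. The Randers metric is a Finsler metric (smooth off the zero section, positively homogeneous of degree one in $y$, with $(g_{ij})=\left(\frac12\frac{\partial^2F^2}{\partial y^i\partial y^j}\right)$ positive definite) if and only if $\sqrt{g(X,X)}<1$; this is assumed. A Finsler metric is of Douglas type if in standard local coordinates its spray coefficients $G^i=\frac14 g^{il}\left([F^2]_{x^my^l}y^m-[F^2]_{x^l}\right)$ have the form $G^i=\frac12\Gamma^i_{jk}(x)y^jy^k+P(x,y)y^i$ with $P$ positively homogeneous of degree one in $y$. A flag $(P,y)$ consists of a 2-dimensional subspace $P$ and a nonzero vector $y\in P$. The flag curvature is $$K^F(P,y)=\frac{g_y(R_y(u),u)}{g_y(y,y)g_y(u,u)-g_y(y,u)^2},$$ where $P=\mathrm{span}\{u,y\}$, $g_y(u,v)=\frac12\frac{\partial^2}{\partial s\,\partial t}F^2(y+su+tv)\big|_{s=t=0}$, $R_y(u)=R(u,y)y=\nabla_u\nabla_yy-\nabla_y\nabla_uy-\nabla_{[u,y]}y$ and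 $\nabla$ is the Chern connection of $F$. *)

theory Defs
  imports "HOL-Analysis.Analysis" "HOL-Algebra.Group"
begin

section \<open>Smooth manifolds and Lie groups\<close>

text \<open>Only used for open sets \<open>S\<close>.\<close>

primrec Ck_on :: "nat \<Rightarrow> 'a::real_normed_vector set \<Rightarrow> ('a \<Rightarrow> 'b::real_normed_vector) \<Rightarrow> bool" where
  "Ck_on 0 S f \<longleftrightarrow> continuous_on S f"
| "Ck_on (Suc k) S f \<longleftrightarrow>
     (\<forall>x\<in>S. f differentiable (at x)) \<and> (\<forall>v. Ck_on k S (\<lambda>x. frechet_derivative f (at x) v))"

definition smooth_on :: "'a::real_normed_vector set \<Rightarrow> ('a \<Rightarrow> 'b::real_normed_vector) \<Rightarrow> bool" where
  "smooth_on S f \<longleftrightarrow> (\<forall>k. Ck_on k S f)"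

text \<open>A chart is a pair of its domain and its coordinate map; the latter is
  only meaningful on the domain.\<close>

type_synonym ('g, 'e) chart = "'g set \<times> ('g \<Rightarrow> 'e)"

definition coords :: "('g, 'e) chart \<Rightarrow> 'e set" where
  "coords c = snd c ` fst c"

definition chart_inv :: "('g, 'e) chart \<Rightarrow> 'e \<Rightarrow> 'g" where
  "chart_inv c = inv_into (fst c) (snd c)"

locale smooth_manifold =
  fixes T :: "'g topology" and A :: "('g, 'e::euclidean_space) chart set"
  assumes hausdorff: "Hausdorff_space T"
    and second_countable: "second_countable T"
    and charts_cover: "\<Union> (fst ` A) = topspace T"
    and chart_domain: "c \<in> A \<Longrightarrow> openin T (fst c)"
    and chart_coords: "c \<in> A \<Longrightarrow> open (coords c)"
    and chart_homeo: "c \<in> A \<Longrightarrow>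
          homeomorphic_map (subtopology T (fst c)) (top_of_set (coords c)) (snd c)"
    and transition_smooth: "c \<in> A \<Longrightarrow> d \<in> A \<Longrightarrow>
          smooth_on (snd c ` (fst c \<inter> fst d)) (snd d \<circ> chart_inv c)"

locale lie_group = group G + smooth_manifold T A
  for G :: "('g, 'm) monoid_scheme" (structure)
    and T :: "'g topology" and A :: "('g, 'e::euclidean_space) chart set" +
  assumes topspace_carrier: "topspace T = carrier G"
    and mult_continuous: "continuous_map (prod_topology T T) T (\<lambda>(p, q). p \<otimes> q)"
    and mult_smooth: "c \<in> A \<Longrightarrow> d \<in> A \<Longrightarrow> k \<in> A \<Longrightarrow>
          smooth_on {(x, y). x \<in> coords c \<and> y \<in> coords d \<and> chart_inv c x \<otimes> chart_inv d y \<in> fst k}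
            (\<lambda>(x, y). snd k (chart_inv c x \<otimes> chart_inv d y))"
    and inv_continuous: "continuous_map T T (\<lambda>p. inv p)"
    and inv_smooth: "c \<in> A \<Longrightarrow> k \<in> A \<Longrightarrow>
          smooth_on {x \<in> coords c. inv (chart_inv c x) \<in> fst k} (\<lambda>x. snd k (inv (chart_inv c x)))"

section \<open>Tensor fields and left invariance\<close>

text \<open>The differential at \<open>p\<close> of a map \<open>f\<close>, written in the chart \<open>c\<close> around \<open>p\<close>
  and the chart \<open>d\<close> around \<open>f p\<close>.\<close>

definition differential ::
  "('g, 'e::euclidean_space) chart \<Rightarrow> ('g, 'e) chart \<Rightarrow> ('g \<Rightarrow> 'g) \<Rightarrow> 'g \<Rightarrow> 'e \<Rightarrow> 'e" where
  "differential c d f p v = frechet_derivative (\<lambda>x. snd d (f (chart_inv c x))) (at (snd c p)) v"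

text \<open>Tensor fields are given by their local representatives: in the chart \<open>c\<close>, at the point with
  coordinates \<open>x\<close>, a vector field is \<open>X c x\<close> and a metric is \<open>g c x\<close>.\<close>

type_synonym ('g, 'e) vfield = "('g, 'e) chart \<Rightarrow> 'e \<Rightarrow> 'e"
type_synonym ('g, 'e) metric_field = "('g, 'e) chart \<Rightarrow> 'e \<Rightarrow> 'e \<Rightarrow> 'e \<Rightarrow> real"

definition vector_field :: "('g, 'e::euclidean_space) chart set \<Rightarrow> ('g, 'e) vfield \<Rightarrow> bool" where
  "vector_field A X \<longleftrightarrow>
     (\<forall>c\<in>A. smooth_on (coords c) (X c)) \<and>
     (\<forall>c\<in>A. \<forall>d\<in>A. \<forall>p\<in>fst c \<inter> fst d.
        X d (snd d p) = differential c d (\<lambda>q. q) p (X c (snd c p)))"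

definition riemannian_metric ::
  "('g, 'e::euclidean_space) chart set \<Rightarrow> ('g, 'e) metric_field \<Rightarrow> bool" where
  "riemannian_metric A g \<longleftrightarrow>
     (\<forall>c\<in>A. \<forall>x\<in>coords c. bilinear (g c x) \<and> (\<forall>v w. g c x v w = g c x w v) \<and>
        (\<forall>v. v \<noteq> 0 \<longrightarrow> 0 < g c x v v)) \<and>
     (\<forall>c\<in>A. \<forall>v w. smooth_on (coords c) (\<lambda>x. g c x v w)) \<and>
     (\<forall>c\<in>A. \<forall>d\<in>A. \<forall>p\<in>fst c \<inter> fst d. \<forall>v w.
        g d (snd d p) (differential c d (\<lambda>q. q) p v) (differential c d (\<lambda>q. q) p w)
          = g c (snd c p) v w)"

definition left_invariant_vfield ::
  "('g, 'm) monoid_scheme \<Rightarrow> ('g, 'e::euclidean_space) chart set \<Rightarrow> ('g, 'e) vfield \<Rightarrow> bool" where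
  "left_invariant_vfield G A X \<longleftrightarrow>
     (\<forall>a\<in>carrier G. \<forall>c\<in>A. \<forall>d\<in>A. \<forall>p\<in>fst c. a \<otimes>\<^bsub>G\<^esub> p \<in> fst d \<longrightarrow>
        X d (snd d (a \<otimes>\<^bsub>G\<^esub> p)) = differential c d (\<lambda>q. a \<otimes>\<^bsub>G\<^esub> q) p (X c (snd c p)))"

definition left_invariant_metric ::
  "('g, 'm) monoid_scheme \<Rightarrow> ('g, 'e::euclidean_space) chart set \<Rightarrow> ('g, 'e) metric_field \<Rightarrow> bool" where
  "left_invariant_metric G A g \<longleftrightarrow>
     (\<forall>a\<in>carrier G. \<forall>c\<in>A. \<forall>d\<in>A. \<forall>p\<in>fst c. a \<otimes>\<^bsub>G\<^esub> p \<in> fst d \<longrightarrow>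
        (\<forall>v w. g d (snd d (a \<otimes>\<^bsub>G\<^esub> p))
            (differential c d (\<lambda>q. a \<otimes>\<^bsub>G\<^esub> q) p v) (differential c d (\<lambda>q. a \<otimes>\<^bsub>G\<^esub> q) p w)
          = g c (snd c p) v w))"

section \<open>The Lie algebra\<close>

text \<open>The Lie algebra is the tangent space at the identity, identified with the model space \<open>'e\<close>
  by means of a chart \<open>c\<close> around the identity. Its bracket is the Lie bracket of left invariant
  vector fields, \<open>[V, W] f = V (W f) - W (V f)\<close>.\<close>

definition left_field ::
  "('g, 'm) monoid_scheme \<Rightarrow> ('g, 'e::euclidean_space) chart \<Rightarrow> 'e \<Rightarrow> 'e \<Rightarrow> 'e" where
  "left_field G c v x = differential c c (\<lambda>q. chart_inv c x \<otimes>\<^bsub>G\<^esub> q) \<one>\<^bsub>G\<^esub> v"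

definition vf_bracket ::
  "('e::real_normed_vector \<Rightarrow> 'e) \<Rightarrow> ('e \<Rightarrow> 'e) \<Rightarrow> 'e \<Rightarrow> 'e" where
  "vf_bracket V W x = frechet_derivative W (at x) (V x) - frechet_derivative V (at x) (W x)"

definition lie_bracket ::
  "('g, 'm) monoid_scheme \<Rightarrow> ('g, 'e::euclidean_space) chart \<Rightarrow> 'e \<Rightarrow> 'e \<Rightarrow> 'e" where
  "lie_bracket G c v w = vf_bracket (left_field G c v) (left_field G c w) (snd c \<one>\<^bsub>G\<^esub>)"

definition class_G1 ::
  "('g, 'm) monoid_scheme \<Rightarrow> ('g, 'e::euclidean_space) chart \<Rightarrow> bool" where
  "class_G1 G c \<longleftrightarrow>
     (\<exists>p\<in>carrier G. \<exists>q\<in>carrier G. p \<otimes>\<^bsub>G\<^esub> q \<noteq> q \<otimes>\<^bsub>G\<^esub> p) \<and>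
     (\<forall>x y. \<exists>r s::real. lie_bracket G c x y = r *\<^sub>R x + s *\<^sub>R y)"

definition commutative_ideal ::
  "('g, 'm) monoid_scheme \<Rightarrow> ('g, 'e::euclidean_space) chart \<Rightarrow> 'e set \<Rightarrow> bool" where
  "commutative_ideal G c \<uu> \<longleftrightarrow> subspace \<uu> \<and>
     (\<forall>x. \<forall>z\<in>\<uu>. lie_bracket G c x z \<in> \<uu>) \<and>
     (\<forall>z\<in>\<uu>. \<forall>w\<in>\<uu>. lie_bracket G c z w = 0)"

section \<open>Local Riemannian and Finsler geometry\<close>

text \<open>From here on, \<open>h x v w\<close> is a Riemannian metric and \<open>F x y\<close> a Finsler metric on an open
  subset of \<open>'e\<close>, i.e. a local representative in some chart.

  Raising an index: \<open>raise h \<phi>\<close> is the vector with components \<open>h\<^sup>i\<^sup>l \<phi>\<^sub>l\<close>.\<close>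

definition raise :: "('e::real_vector \<Rightarrow> 'e \<Rightarrow> real) \<Rightarrow> ('e \<Rightarrow> real) \<Rightarrow> 'e" where
  "raise h \<phi> = (THE a. \<forall>z. h a z = \<phi> z)"

definition levi_civita ::
  "('e::euclidean_space \<Rightarrow> 'e \<Rightarrow> 'e \<Rightarrow> real) \<Rightarrow> 'e \<Rightarrow> 'e \<Rightarrow> 'e \<Rightarrow> 'e" where
  "levi_civita h x u w = raise (h x) (\<lambda>z.
     (1/2) * (frechet_derivative (\<lambda>x. h x w z) (at x) u
            + frechet_derivative (\<lambda>x. h x u z) (at x) w
            - frechet_derivative (\<lambda>x. h x u w) (at x) z))"

definition levi_civita_deriv ::
  "('e::euclidean_space \<Rightarrow> 'e \<Rightarrow> 'e \<Rightarrow> real) \<Rightarrow> 'e \<Rightarrow> ('e \<Rightarrow> 'e) \<Rightarrow> 'e \<Rightarrow> 'e" where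
  "levi_civita_deriv h u Z x = frechet_derivative Z (at x) u + levi_civita h x u (Z x)"

text \<open>\<open>R(u,w)z = \<nabla>\<^sub>u \<nabla>\<^sub>w z - \<nabla>\<^sub>w \<nabla>\<^sub>u z - \<nabla>\<^sub>[\<^sub>u\<^sub>,\<^sub>w\<^sub>] z\<close> for vector fields \<open>u\<close>, \<open>w\<close>, \<open>z\<close> with constant
  coordinates, so that \<open>[u,w] = 0\<close>.\<close>

definition riemann_curvature ::
  "('e::euclidean_space \<Rightarrow> 'e \<Rightarrow> 'e \<Rightarrow> real) \<Rightarrow> 'e \<Rightarrow> 'e \<Rightarrow> 'e \<Rightarrow> 'e \<Rightarrow> 'e" where
  "riemann_curvature h x u w z =
     levi_civita_deriv h u (levi_civita_deriv h w (\<lambda>x. z)) x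
     - levi_civita_deriv h w (levi_civita_deriv h u (\<lambda>x. z)) x"

definition sectional_curvature ::
  "('e::euclidean_space \<Rightarrow> 'e \<Rightarrow> 'e \<Rightarrow> real) \<Rightarrow> 'e \<Rightarrow> 'e set \<Rightarrow> real" where
  "sectional_curvature h x P = (THE k. \<forall>u w. P = span {u, w} \<longrightarrow>
     k = h x (riemann_curvature h x u w w) u / (h x w w * h x u u - (h x w u)\<^sup>2))"

definition fundamental_tensor ::
  "('e::euclidean_space \<Rightarrow> 'e \<Rightarrow> real) \<Rightarrow> 'e \<Rightarrow> 'e \<Rightarrow> 'e \<Rightarrow> 'e \<Rightarrow> real" where
  "fundamental_tensor F x y u v =
     (1/2) * deriv (\<lambda>s. deriv (\<lambda>t. (F x (y + s *\<^sub>R u + t *\<^sub>R v))\<^sup>2) 0) 0"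

text \<open>\<open>G\<^sup>i = 1/4 g\<^sup>i\<^sup>l ([F\<^sup>2]\<^sub>x\<^sub>m\<^sub>y\<^sub>l y\<^sup>m - [F\<^sup>2]\<^sub>x\<^sub>l)\<close>\<close>

definition spray :: "('e::euclidean_space \<Rightarrow> 'e \<Rightarrow> real) \<Rightarrow> 'e \<Rightarrow> 'e \<Rightarrow> 'e" where
  "spray F x y = raise (fundamental_tensor F x y) (\<lambda>z.
     (1/4) * (frechet_derivative (\<lambda>x. frechet_derivative (\<lambda>y. (F x y)\<^sup>2) (at y) z) (at x) y
            - frechet_derivative (\<lambda>x. (F x y)\<^sup>2) (at x) z))"

text \<open>\<open>N\<^sup>i\<^sub>j = \<partial>G\<^sup>i/\<partial>y\<^sup>j\<close>, and differentiation along the horizontal lift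
  \<open>\<delta>/\<delta>x\<^sup>j = \<partial>/\<partial>x\<^sup>j - N\<^sup>i\<^sub>j \<partial>/\<partial>y\<^sup>i\<close> of a vector \<open>u\<close>.\<close>

definition nonlinear_connection ::
  "('e::euclidean_space \<Rightarrow> 'e \<Rightarrow> real) \<Rightarrow> 'e \<Rightarrow> 'e \<Rightarrow> 'e \<Rightarrow> 'e" where
  "nonlinear_connection F x y u = frechet_derivative (spray F x) (at y) u"

definition horizontal_deriv ::
  "('e::euclidean_space \<Rightarrow> 'e \<Rightarrow> real) \<Rightarrow> 'e \<Rightarrow> ('e \<Rightarrow> 'e \<Rightarrow> 'b::real_normed_vector) \<Rightarrow> 'e \<Rightarrow> 'e \<Rightarrow> 'b"
  where
  "horizontal_deriv F u f x y = frechet_derivative (\<lambda>x. f x y) (at x) u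
     - frechet_derivative (f x) (at y) (nonlinear_connection F x y u)"

text \<open>Connection coefficients of the Chern connection:
  \<open>\<Gamma>\<^sup>i\<^sub>j\<^sub>k = 1/2 g\<^sup>i\<^sup>l (\<delta>g\<^sub>l\<^sub>k/\<delta>x\<^sup>j + \<delta>g\<^sub>j\<^sub>l/\<delta>x\<^sup>k - \<delta>g\<^sub>j\<^sub>k/\<delta>x\<^sup>l)\<close>.\<close>

definition chern_coeff ::
  "('e::euclidean_space \<Rightarrow> 'e \<Rightarrow> real) \<Rightarrow> 'e \<Rightarrow> 'e \<Rightarrow> 'e \<Rightarrow> 'e \<Rightarrow> 'e" where
  "chern_coeff F x y u w = raise (fundamental_tensor F x y) (\<lambda>z.
     (1/2) * (horizontal_deriv F u (\<lambda>x y. fundamental_tensor F x y w z) x y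
            + horizontal_deriv F w (\<lambda>x y. fundamental_tensor F x y u z) x y
            - horizontal_deriv F z (\<lambda>x y. fundamental_tensor F x y u w) x y))"

text \<open>The Chern connection lives on the pullback of the tangent bundle to the slit tangent bundle;
  \<open>chern_deriv F u Z\<close> is the covariant derivative of a section \<open>Z x y\<close> along the horizontal lift of
  the coordinate-constant vector field \<open>u\<close>.\<close>

definition chern_deriv ::
  "('e::euclidean_space \<Rightarrow> 'e \<Rightarrow> real) \<Rightarrow> 'e \<Rightarrow> ('e \<Rightarrow> 'e \<Rightarrow> 'e) \<Rightarrow> 'e \<Rightarrow> 'e \<Rightarrow> 'e" where
  "chern_deriv F u Z x y = horizontal_deriv F u Z x y + chern_coeff F x y u (Z x y)"

text \<open>\<open>R(u,w)z = \<nabla>\<^sub>u \<nabla>\<^sub>w z - \<nabla>\<^sub>w \<nabla>\<^sub>u z - \<nabla>\<^sub>[\<^sub>u\<^sub>,\<^sub>w\<^sub>] z\<close> for \<open>u\<close>, \<open>w\<close>, \<open>z\<close> with constant coordinates.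
  The last term vanishes: the bracket of the horizontal lifts is vertical, and the Chern connection
  has no vertical coefficients.\<close>

definition chern_curvature ::
  "('e::euclidean_space \<Rightarrow> 'e \<Rightarrow> real) \<Rightarrow> 'e \<Rightarrow> 'e \<Rightarrow> 'e \<Rightarrow> 'e \<Rightarrow> 'e \<Rightarrow> 'e" where
  "chern_curvature F x y u w z =
     chern_deriv F u (chern_deriv F w (\<lambda>x y. z)) x y
     - chern_deriv F w (chern_deriv F u (\<lambda>x y. z)) x y"

definition flag :: "'e::euclidean_space set \<Rightarrow> 'e \<Rightarrow> bool" where
  "flag P y \<longleftrightarrow> subspace P \<and> dim P = 2 \<and> y \<in> P \<and> y \<noteq> 0"

definition flag_curvature ::
  "('e::euclidean_space \<Rightarrow> 'e \<Rightarrow> real) \<Rightarrow> 'e \<Rightarrow> 'e set \<Rightarrow> 'e \<Rightarrow> real" where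
  "flag_curvature F x P y = (THE k. \<forall>u. P = span {u, y} \<longrightarrow>
     (let g\<^sub>y = fundamental_tensor F x y; R\<^sub>y = (\<lambda>u. chern_curvature F x y u y y)
      in k = g\<^sub>y (R\<^sub>y u) u / (g\<^sub>y y y * g\<^sub>y u u - (g\<^sub>y y u)\<^sup>2)))"

section \<open>Randers metrics and Douglas metrics\<close>

definition randers ::
  "('g, 'e::euclidean_space) metric_field \<Rightarrow> ('g, 'e) vfield \<Rightarrow> ('g, 'e) chart \<Rightarrow> 'e \<Rightarrow> 'e \<Rightarrow> real" where
  "randers g X c x y = sqrt (g c x y y) + g c x (X c x) y"

definition douglas_type ::
  "('g, 'e::euclidean_space) chart set \<Rightarrow> (('g, 'e) chart \<Rightarrow> 'e \<Rightarrow> 'e \<Rightarrow> real) \<Rightarrow> bool" where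
  "douglas_type A F \<longleftrightarrow> (\<forall>c\<in>A. \<exists>\<Gamma> P.
     (\<forall>x\<in>coords c. bilinear (\<Gamma> x)) \<and>
     (\<forall>x\<in>coords c. \<forall>y r. y \<noteq> 0 \<longrightarrow> (0::real) < r \<longrightarrow> P x (r *\<^sub>R y) = r * P x y) \<and>
     (\<forall>x\<in>coords c. \<forall>y. y \<noteq> 0 \<longrightarrow> spray (F c) x y = (1/2) *\<^sub>R \<Gamma> x y y + P x y *\<^sub>R y))"

end

theory Submission
  imports Defs
begin

text \<open>Let \<open>\<omega>\<close> be the left invariant one-form with \<open>\<omega> b = 1\<close> and kernel \<open>\<uu>\<close>, and let
  \<open>\<beta> = g b b\<close>. Koszul's formula and \<open>[b, z] = z\<close> give
  \<open>\<nabla>\<omega> = \<omega> \<otimes> \<omega> - g / \<beta>\<close>. Hence the one-form \<open>\<xi> \<beta> \<omega>\<close> of \<open>F\<close> is closed, and \<open>F\<close> has the spray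
  of \<open>g\<close> plus \<open>P y\<close>, where \<open>P = \<xi> \<beta> (\<nabla>\<omega>)(y, y) / (2 F)\<close>. For the spray \<open>G\<^sub>g + P y\<close> the curvature is
  \<open>R\<^sub>y u = R\<^sup>g(u, y) y + \<Xi> u + \<tau>(u) y\<close> with \<open>\<Xi> = P\<^sup>2 - P\<^sub>|\<^sub>0\<close>, where
  \<open>P\<^sub>|\<^sub>0\<close> is the derivative of \<open>P\<close> along the geodesics of \<open>g\<close>, and \<open>R\<^sub>y u\<close> is \<open>g\<^sub>y\<close>-orthogonal to \<open>y\<close>,
  which determines \<open>\<tau>\<close> and yields \<open>K\<^sup>F = (g(y, y) K\<^sup>g + \<Xi>) / F\<^sup>2\<close>. Finally
  \<open>(\<nabla>\<omega>)(y, y) = - g(v, v) / \<beta>\<close> makes \<open>\<Xi>\<close> explicit.\<close>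

section \<open>Derivatives and linear systems\<close>

text \<open>The curvature is wanted at the identity only, but it takes derivatives of the
  connection, so the formula for \<open>\<nabla>\<omega>\<close> must hold on a whole chart, whereas
  \<open>lie_bracket\<close> is evaluated at the identity alone. Left translation carries the
  bracket to the other points (\<open>left_field_bracket\<close>). That formula also makes the
  computation close up: it expresses derivatives of \<omega> by \<omega> and the metric again, so
  each later derivative is rational in the same few quantities and derivatives of \<Gamma> survive
  only inside the Riemannian curvature. The technical obstacle is that \<Gamma> and the Chern
  coefficients are given implicitly, as solutions of linear systems (\<open>raise\<close>), so their
  differentiability has to be drawn from these systems. The multiple of \<open>y\<close> in the
  curvature is computed and not inferred: \<open>chern_curvature_eq\<close> finds it from the
  derivatives of \<open>P\<close>, and \<open>\<omega>_Rm\<close> shows that it has the value that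
  orthogonality demands.\<close>

lemma second_difference_tendsto:
  fixes f :: "'a::real_normed_vector \<Rightarrow> real"
  assumes S: "open S" "x0 \<in> S" and f: "\<And>x. x \<in> S \<Longrightarrow> (f has_derivative f' x) (at x)"
    and D: "((\<lambda>x. f' x u) has_derivative D) (at x0)"
  shows "((\<lambda>t. (f (x0 + t *\<^sub>R u + t *\<^sub>R w) - f (x0 + t *\<^sub>R u) - f (x0 + t *\<^sub>R w) + f x0) / t\<^sup>2)
    \<longlongrightarrow> D w) (at_right 0)"
proof (rule tendstoI)
  fix e :: real assume "e > 0"
  define m where "m = norm u + norm w + 1"
  have m: "m > 0" by (simp add: m_def add_nonneg_pos)
  \<comment> \<open>The argument leaves two linearization errors of at most
    \<open>e' * (t * m)\<close> each; with this choice they add up to two thirds of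
    \<open>e * t\<close>.\<close>
  define e' where "e' = e / (3 * m)"
  have e': "e' > 0" using \<open>e > 0\<close> m by (simp add: e'_def)
  have linD: "linear D" using D has_derivative_linear by blast
  obtain r where r: "r > 0" "ball x0 r \<subseteq> S" using S open_contains_ball by blast
  obtain d where d: "d > 0" "\<And>y. norm (y - x0) < d \<Longrightarrow>
      norm (f' y u - f' x0 u - D (y - x0)) \<le> e' * norm (y - x0)"
    using D e' unfolding has_derivative_at_alt by blast
  define t0 where "t0 = min r d / m"
  have t0: "t0 > 0" using r d m by (simp add: t0_def)
  have "dist ((f (x0 + t *\<^sub>R u + t *\<^sub>R w) - f (x0 + t *\<^sub>R u) - f (x0 + t *\<^sub>R w) + f x0) / t\<^sup>2) (D w) < e"
    if t: "0 < t" "t < t0" for t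
  proof -
    have small: "norm (a *\<^sub>R u + b *\<^sub>R w) \<le> t * m" "norm (a *\<^sub>R u + b *\<^sub>R w) < r"
      "norm (a *\<^sub>R u + b *\<^sub>R w) < d"
      if "0 \<le> a" "a \<le> t" "0 \<le> b" "b \<le> t" for a b
    proof -
      have "norm (a *\<^sub>R u + b *\<^sub>R w) \<le> a * norm u + b * norm w"
        by (rule norm_triangle_le) (use that in simp)
      also have "\<dots> \<le> t * norm u + t * norm w"
        using that by (intro add_mono mult_right_mono) auto
      also have "\<dots> \<le> t * m" using t by (simp add: m_def algebra_simps)
      finally show 1: "norm (a *\<^sub>R u + b *\<^sub>R w) \<le> t * m" .
      also have "t * m < min r d" using t m by (simp add: t0_def pos_less_divide_eq)
      finally show "norm (a *\<^sub>R u + b *\<^sub>R w) < r" "norm (a *\<^sub>R u + b *\<^sub>R w) < d" by auto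
    qed
    \<comment> \<open>The mean value theorem for this increment, in the direction \<open>u\<close>,
      turns the second difference into \<open>t\<close> times a difference of first derivatives.
      That difference is compared with \<open>D\<close> by differentiability at \<open>x0\<close>
      alone, without continuity of second derivatives.\<close>
    define g where "g s = f (x0 + s *\<^sub>R u + t *\<^sub>R w) - f (x0 + s *\<^sub>R u)" for s
    have g: "(g has_real_derivative (f' (x0 + s *\<^sub>R u + t *\<^sub>R w) u - f' (x0 + s *\<^sub>R u) u)) (at s)"
      if s: "0 \<le> s" "s \<le> t" for s
    proof -
      have "x0 + s *\<^sub>R u + t *\<^sub>R w \<in> S" "x0 + s *\<^sub>R u \<in> S"
        using small(2)[of s t] small(2)[of s 0] s t r(2)
        by (auto simp: dist_norm subset_iff norm_minus_commute algebra_simps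
          simp flip: minus_add_distrib diff_diff_eq)
      then have d12: "(f has_derivative f' (x0 + s *\<^sub>R u + t *\<^sub>R w)) (at (x0 + s *\<^sub>R u + t *\<^sub>R w))"
        "(f has_derivative f' (x0 + s *\<^sub>R u)) (at (x0 + s *\<^sub>R u))"
        using f by auto
      have "((\<lambda>s. f (x0 + s *\<^sub>R u + t *\<^sub>R w)) has_derivative (\<lambda>k. f' (x0 + s *\<^sub>R u + t *\<^sub>R w) (k *\<^sub>R u))) (at s)"
        by (rule has_derivative_compose[where g = f and f = "\<lambda>s. x0 + s *\<^sub>R u + t *\<^sub>R w", OF _ d12(1)])
          (auto intro!: derivative_eq_intros)
      moreover have "((\<lambda>s. f (x0 + s *\<^sub>R u)) has_derivative (\<lambda>k. f' (x0 + s *\<^sub>R u) (k *\<^sub>R u))) (at s)"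
        by (rule has_derivative_compose[where g = f and f = "\<lambda>s. x0 + s *\<^sub>R u", OF _ d12(2)])
          (auto intro!: derivative_eq_intros)
      ultimately have "(g has_derivative (\<lambda>k. f' (x0 + s *\<^sub>R u + t *\<^sub>R w) (k *\<^sub>R u) - f' (x0 + s *\<^sub>R u) (k *\<^sub>R u))) (at s)"
        unfolding g_def by (rule has_derivative_diff)
      moreover have "f' (x0 + s *\<^sub>R u + t *\<^sub>R w) (k *\<^sub>R u) - f' (x0 + s *\<^sub>R u) (k *\<^sub>R u)
        = (f' (x0 + s *\<^sub>R u + t *\<^sub>R w) u - f' (x0 + s *\<^sub>R u) u) * k" for k
        using d12[THEN has_derivative_linear] by (simp add: linear_cmul left_diff_distrib)
      ultimately show ?thesis by (simp add: has_field_derivative_def)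
    qed
    then obtain s where s: "0 < s" "s < t"
      "g t - g 0 = (t - 0) * (f' (x0 + s *\<^sub>R u + t *\<^sub>R w) u - f' (x0 + s *\<^sub>R u) u)"
      using MVT2[OF t(1) g] by blast
    define p where "p = s *\<^sub>R u + t *\<^sub>R w"
    define q where "q = s *\<^sub>R u"
    have "\<bar>f' (x0 + p) u - f' x0 u - D p\<bar> \<le> e' * norm p"
      using d(2)[of "x0 + p"] small(3)[of s t] s t by (simp add: p_def)
    also have "\<dots> \<le> e' * (t * m)" using small(1)[of s t] s t e' by (simp add: p_def)
    finally have 1: "\<bar>f' (x0 + p) u - f' x0 u - D p\<bar> \<le> e' * (t * m)" .
    have "\<bar>f' (x0 + q) u - f' x0 u - D q\<bar> \<le> e' * norm q"
      using d(2)[of "x0 + q"] small(3)[of s 0] s t by (simp add: q_def)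
    also have "\<dots> \<le> e' * (t * m)" using small(1)[of s 0] s t e' by (simp add: q_def)
    finally have 2: "\<bar>f' (x0 + q) u - f' x0 u - D q\<bar> \<le> e' * (t * m)" .
    have Dpq: "D p - D q = t * D w" using linD by (simp add: p_def q_def linear_add linear_cmul)
    have "\<bar>f' (x0 + p) u - f' (x0 + q) u - t * D w\<bar> \<le> 2 * (e' * (t * m))"
      using 1 2 unfolding Dpq[symmetric] by linarith
    then have "\<bar>t * (f' (x0 + p) u - f' (x0 + q) u) - t\<^sup>2 * D w\<bar> \<le> t * (2 * (e' * (t * m)))"
      using t by (simp add: power2_eq_square abs_mult mult.assoc flip: right_diff_distrib)
    also have "\<dots> = t\<^sup>2 * (2 / 3 * e)" using m by (simp add: e'_def power2_eq_square)
    finally have 3: "\<bar>t * (f' (x0 + p) u - f' (x0 + q) u) - t\<^sup>2 * D w\<bar> \<le> t\<^sup>2 * (2 / 3 * e)" .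
    have eq: "f (x0 + t *\<^sub>R u + t *\<^sub>R w) - f (x0 + t *\<^sub>R u) - f (x0 + t *\<^sub>R w) + f x0
      = t * (f' (x0 + p) u - f' (x0 + q) u)"
      using s(3) by (simp add: g_def p_def q_def add.assoc)
    have "dist ((t * (f' (x0 + p) u - f' (x0 + q) u)) / t\<^sup>2) (D w)
      = \<bar>t * (f' (x0 + p) u - f' (x0 + q) u) - t\<^sup>2 * D w\<bar> / t\<^sup>2"
      using t by (simp add: dist_real_def divide_simps abs_divide mult.commute[of _ "D w"] flip: abs_mult)
    also have "\<dots> \<le> 2 / 3 * e" using 3 t by (simp add: pos_divide_le_eq mult.commute)
    also have "\<dots> < e" using \<open>e > 0\<close> by simp
    finally show ?thesis unfolding eq .
  qed
  then show "eventually (\<lambda>t. dist ((f (x0 + t *\<^sub>R u + t *\<^sub>R w) - f (x0 + t *\<^sub>R u) - f (x0 + t *\<^sub>R w) + f x0) / t\<^sup>2) (D w) < e) (at_right 0)"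
    using t0 by (auto simp: eventually_at_right[OF t0])
qed

text \<open>The second difference is symmetric in \<open>u\<close> and \<open>w\<close>, and its
  quotient by \<open>t\<^sup>2\<close> tends to either mixed derivative. The vector version drives
  \<open>h_Rm_self\<close>, \<open>\<omega>_Rm\<close> and
  \<open>left_field_bracket\<close>.\<close>

lemma symmetric_second_derivative_real:
  fixes f :: "'a::real_normed_vector \<Rightarrow> real"
  assumes S: "open S" "x0 \<in> S" and f: "\<And>x. x \<in> S \<Longrightarrow> (f has_derivative f' x) (at x)"
    and D: "((\<lambda>x. f' x u) has_derivative D) (at x0)"
    and E: "((\<lambda>x. f' x w) has_derivative E) (at x0)"
  shows "D w = E u"
proof -
  have "((\<lambda>t. (f (x0 + t *\<^sub>R u + t *\<^sub>R w) - f (x0 + t *\<^sub>R u) - f (x0 + t *\<^sub>R w) + f x0) / t\<^sup>2)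
    \<longlongrightarrow> E u) (at_right 0)"
    using second_difference_tendsto[OF S f E, of u] by (simp add: algebra_simps)
  then show ?thesis
    using second_difference_tendsto[OF S f D, of w] tendsto_unique trivial_limit_at_right_real by blast
qed

lemma symmetric_second_derivative:
  fixes f :: "'a::real_normed_vector \<Rightarrow> 'b::euclidean_space"
  assumes S: "open S" "x0 \<in> S" and f: "\<And>x. x \<in> S \<Longrightarrow> (f has_derivative f' x) (at x)"
    and D: "((\<lambda>x. f' x u) has_derivative D) (at x0)"
    and E: "((\<lambda>x. f' x w) has_derivative E) (at x0)"
  shows "D w = E u"
proof (rule euclidean_eqI)
  fix i :: 'b
  show "D w \<bullet> i = E u \<bullet> i"
  proof (rule symmetric_second_derivative_real[OF S])
    show "((\<lambda>x. f x \<bullet> i) has_derivative (\<lambda>k. f' x k \<bullet> i)) (at x)" if "x \<in> S" for x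
      using f[OF that] by (auto intro!: derivative_eq_intros)
  qed (use D E in \<open>auto intro!: derivative_eq_intros\<close>)
qed

lemma has_derivative_cong_open:
  assumes "(f has_derivative f') (at x)" "open S" "x \<in> S" "\<And>y. y \<in> S \<Longrightarrow> f y = g y"
  shows "(g has_derivative f') (at x)"
  using has_derivative_transform_within_open[OF assms(1-3)] assms(4) by auto

lemma differentiable_cong_open:
  assumes "f differentiable (at x)" "open S" "x \<in> S" "\<And>y. y \<in> S \<Longrightarrow> f y = g y"
  shows "g differentiable (at x)"
  using assms has_derivative_cong_open unfolding differentiable_def by blast

text \<open>Differentiability is known only for each fixed vector \<open>v\<close>. Expanding in a
  basis makes \<open>L q (a q)\<close> a finite sum of products, so no topology on a space of linear
  maps enters.\<close>

lemma linear_family_has_derivative: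
  fixes L :: "'p::real_normed_vector \<Rightarrow> 'a::euclidean_space \<Rightarrow> 'b::real_normed_vector"
  assumes S: "open S" "p \<in> S" and lin: "\<And>q. q \<in> S \<Longrightarrow> linear (L q)"
    and L: "\<And>v. ((\<lambda>q. L q v) has_derivative (\<lambda>d. L' d v)) (at p)"
    and a: "(a has_derivative a') (at p)"
  shows "((\<lambda>q. L q (a q)) has_derivative (\<lambda>d. L' d (a p) + L p (a' d))) (at p)"
proof -
  have expand: "L q v = (\<Sum>i\<in>Basis. (v \<bullet> i) *\<^sub>R L q i)" if "q \<in> S" for q v
  proof -
    have "L q v = L q (\<Sum>i\<in>Basis. (v \<bullet> i) *\<^sub>R i)" by (simp add: euclidean_representation)
    then show ?thesis using lin[OF that] by (simp add: linear_sum linear_cmul)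
  qed
  have d: "((\<lambda>q. \<Sum>i\<in>Basis. (v q \<bullet> i) *\<^sub>R L q i) has_derivative
      (\<lambda>d. \<Sum>i\<in>Basis. (v p \<bullet> i) *\<^sub>R L' d i + (v' d \<bullet> i) *\<^sub>R L p i)) (at p)"
    if "(v has_derivative v') (at p)" for v v'
    by (rule has_derivative_sum) (auto intro!: derivative_eq_intros L that)
  \<comment> \<open>\<open>L'\<close> is not assumed linear in \<open>v\<close>; uniqueness of the
    derivative supplies this.\<close>
  have L'exp: "L' d v = (\<Sum>i\<in>Basis. (v \<bullet> i) *\<^sub>R L' d i)" for d v
  proof -
    have "((\<lambda>q. L q v) has_derivative (\<lambda>d. \<Sum>i\<in>Basis. (v \<bullet> i) *\<^sub>R L' d i)) (at p)"
    proof (rule has_derivative_cong_open[OF _ S])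
      show "((\<lambda>q. \<Sum>i\<in>Basis. (v \<bullet> i) *\<^sub>R L q i) has_derivative (\<lambda>d. \<Sum>i\<in>Basis. (v \<bullet> i) *\<^sub>R L' d i)) (at p)"
        using d[of "\<lambda>_. v" "\<lambda>_. 0"] by simp
    qed (rule expand[symmetric])
    from fun_cong[OF has_derivative_unique[OF this L], of d] show ?thesis by (rule sym)
  qed
  have "((\<lambda>q. \<Sum>i\<in>Basis. (a q \<bullet> i) *\<^sub>R L q i) has_derivative
      (\<lambda>d. L' d (a p) + L p (a' d))) (at p)"
    using d[OF a] by (simp add: sum.distrib L'exp[of _ "a p"] expand[OF S(2), of "a' _"])
  then show ?thesis
    by (rule has_derivative_cong_open[OF _ S]) (rule expand[symmetric])
qed

lemma linear_family_differentiable: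
  fixes L :: "'p::real_normed_vector \<Rightarrow> 'a::euclidean_space \<Rightarrow> 'b::real_normed_vector"
  assumes S: "open S" "p \<in> S" and lin: "\<And>q. q \<in> S \<Longrightarrow> linear (L q)"
    and L: "\<And>v. (\<lambda>q. L q v) differentiable (at p)"
    and a: "a differentiable (at p)"
  shows "(\<lambda>q. L q (a q)) differentiable (at p)"
proof -
  obtain a' where a': "(a has_derivative a') (at p)" using a differentiable_def by blast
  show ?thesis
    by (rule differentiableI[OF linear_family_has_derivative[OF S lin L[unfolded frechet_derivative_works] a']])
qed

lemma bilinear_family_has_derivative:
  fixes B :: "'p::real_normed_vector \<Rightarrow> 'a::euclidean_space \<Rightarrow> 'c::euclidean_space \<Rightarrow> 'b::real_normed_vector"
  assumes S: "open S" "p \<in> S" and bil: "\<And>q. q \<in> S \<Longrightarrow> bilinear (B q)"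
    and B: "\<And>v w. ((\<lambda>q. B q v w) has_derivative (\<lambda>d. B' d v w)) (at p)"
    and a: "(a has_derivative a') (at p)" and b: "(b has_derivative b') (at p)"
  shows "((\<lambda>q. B q (a q) (b q)) has_derivative
    (\<lambda>d. B' d (a p) (b p) + B p (a' d) (b p) + B p (a p) (b' d))) (at p)"
proof -
  have "((\<lambda>q. B q (a q) w) has_derivative (\<lambda>d. B' d (a p) w + B p (a' d) w)) (at p)" for w
    by (rule linear_family_has_derivative[OF S _ B a]) (use bil in \<open>auto simp: bilinear_def\<close>)
  from linear_family_has_derivative[where L = "\<lambda>q. B q (a q)", OF S _ this b] show ?thesis
    using bil by (auto simp: bilinear_def)
qed

lemma bilinear_family_differentiable:
  fixes B :: "'p::real_normed_vector \<Rightarrow> 'a::euclidean_space \<Rightarrow> 'c::euclidean_space \<Rightarrow> 'b::real_normed_vector"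
  assumes S: "open S" "p \<in> S" and bil: "\<And>q. q \<in> S \<Longrightarrow> bilinear (B q)"
    and B: "\<And>v w. (\<lambda>q. B q v w) differentiable (at p)"
    and a: "a differentiable (at p)" and b: "b differentiable (at p)"
  shows "(\<lambda>q. B q (a q) (b q)) differentiable (at p)"
proof -
  have "(\<lambda>q. B q (a q) w) differentiable (at p)" for w
    by (rule linear_family_differentiable[OF S _ B a]) (use bil in \<open>auto simp: bilinear_def\<close>)
  from linear_family_differentiable[where L = "\<lambda>q. B q (a q)", OF S _ this b] show ?thesis
    using bil by (auto simp: bilinear_def)
qed

section \<open>Positive definite forms and solutions of linear systems\<close>

definition pos_definite :: "('e::real_vector \<Rightarrow> 'e \<Rightarrow> real) \<Rightarrow> bool" where
  "pos_definite B \<longleftrightarrow> bilinear B \<and> (\<forall>v. v \<noteq> 0 \<longrightarrow> 0 < B v v)"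

lemma pos_definite_eqI:
  assumes B: "pos_definite B" and eq: "\<And>z. B a z = B a' z"
  shows "a = a'"
proof (rule ccontr)
  assume "a \<noteq> a'"
  then have "0 < B (a - a') (a - a')" using B by (simp add: pos_definite_def)
  then show False using eq[of "a - a'"] B bilinear_lsub[of B] by (simp add: pos_definite_def)
qed

lemma raise_eqI:
  assumes B: "pos_definite B" and eq: "\<And>z. B a z = \<phi> z"
  shows "raise B \<phi> = a"
  unfolding raise_def
proof (rule the_equality)
  show "\<forall>z. B a z = \<phi> z" using eq by simp
  show "a' = a" if "\<forall>z. B a' z = \<phi> z" for a'
    by (rule pos_definite_eqI[OF B]) (use that eq in simp)
qed

text \<open>Through the inner product, \<open>B\<close> becomes an injective linear endomorphism
  \<open>L\<close>; in finite dimension it is onto, so the \<open>THE\<close> in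
  \<open>raise\<close> denotes a solution.\<close>

lemma raise:
  fixes B :: "'e::euclidean_space \<Rightarrow> 'e \<Rightarrow> real"
  assumes B: "pos_definite B" and \<phi>: "linear \<phi>"
  shows "B (raise B \<phi>) z = \<phi> z"
proof -
  have bil: "bilinear B" using B by (simp add: pos_definite_def)
  define L where "L a = (\<Sum>i\<in>Basis. B a i *\<^sub>R i)" for a :: 'e
  have expand: "\<psi> z = (\<Sum>i\<in>Basis. \<psi> i *\<^sub>R i) \<bullet> z" if "linear \<psi>" for \<psi> :: "'e \<Rightarrow> real" and z
  proof -
    have "\<psi> z = \<psi> (\<Sum>i\<in>Basis. (z \<bullet> i) *\<^sub>R i)" by (simp add: euclidean_representation)
    then show ?thesis using that
      by (simp add: linear_sum linear_cmul inner_sum_right inner_commute[of _ z] mult.commute)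
  qed
  have LB: "L a \<bullet> z = B a z" for a z
    using expand[of "B a" z] bil by (simp add: L_def bilinear_def)
  have "linear L" unfolding L_def
    by (intro linearI) (use bil in \<open>auto simp: bilinear_ladd bilinear_lmul scaleR_add_left sum.distrib scaleR_sum_right\<close>)
  moreover have "inj L"
    by (rule injI) (metis LB B pos_definite_eqI)
  ultimately have "surj L" by (rule linear_injective_imp_surjective) simp
  then obtain a where "L a = (\<Sum>i\<in>Basis. \<phi> i *\<^sub>R i)" by (metis surjD)
  then have eq: "B a z = \<phi> z" for z using LB[of a z] expand[OF \<phi>, of z] by simp
  show ?thesis by (simp add: raise_eqI[OF B eq] eq)
qed

lemma pos_definite_coercive:
  fixes B :: "'e::euclidean_space \<Rightarrow> 'e \<Rightarrow> real"
  assumes B: "pos_definite B"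
  shows "\<exists>m>0. \<forall>v. m * (norm v)\<^sup>2 \<le> B v v"
proof -
  have bil: "bilinear B" using B by (simp add: pos_definite_def)
  have bb: "bounded_bilinear B" by (rule bilinear_conv_bounded_bilinear[THEN iffD1, OF bil])
  have cont: "continuous_on (sphere 0 1) (\<lambda>v. B v v)"
    by (intro bounded_bilinear.continuous_on[OF bb] continuous_intros)
  have "compact (sphere 0 1 :: 'e set)" "sphere 0 1 \<noteq> ({} :: 'e set)" by auto
  from continuous_attains_inf[OF this cont]
  obtain v0 where v0: "v0 \<in> sphere 0 1" "\<And>v. v \<in> sphere 0 1 \<Longrightarrow> B v0 v0 \<le> B v v" by blast
  have "B v0 v0 * (norm v)\<^sup>2 \<le> B v v" for v
  proof (cases "v = 0")
    case True then show ?thesis using bil by (simp add: bilinear_lzero)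
  next
    case False
    have "B v0 v0 \<le> B (inverse (norm v) *\<^sub>R v) (inverse (norm v) *\<^sub>R v)"
      by (rule v0(2)) (use False in simp)
    then have "B v0 v0 \<le> B v v / (norm v)\<^sup>2"
      using bil by (simp add: bilinear_lmul bilinear_rmul power2_eq_square field_simps)
    then show ?thesis using False by (simp add: pos_le_divide_eq)
  qed
  moreover have "v0 \<noteq> 0" using v0(1) by auto
  then have "B v0 v0 > 0" using B by (simp add: pos_definite_def)
  ultimately show ?thesis by blast
qed

text \<open>Solutions of a linear system depend continuously on the system: coercivity at \<open>p\<close> bounds the
  error by the residual.\<close>

lemma raise_isCont:
  fixes B :: "'p::real_normed_vector \<Rightarrow> 'e::euclidean_space \<Rightarrow> 'e \<Rightarrow> real"
  assumes S: "open S" "p \<in> S" and B: "\<And>q. q \<in> S \<Longrightarrow> pos_definite (B q)"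
    and lin: "\<And>q. q \<in> S \<Longrightarrow> linear (\<phi> q)"
    and Bc: "\<And>v w. isCont (\<lambda>q. B q v w) p" and \<phi>c: "\<And>z. isCont (\<lambda>q. \<phi> q z) p"
  shows "isCont (\<lambda>q. raise (B q) (\<phi> q)) p"
proof -
  define a where "a q = raise (B q) (\<phi> q)" for q
  have a: "B q (a q) z = \<phi> q z" if "q \<in> S" for q z
    unfolding a_def by (rule raise[OF B lin]) (use that in auto)
  have bil: "bilinear (B q)" if "q \<in> S" for q using B[OF that] by (simp add: pos_definite_def)
  obtain m where m: "m > 0" "\<And>v. m * (norm v)\<^sup>2 \<le> B p v v"
    using pos_definite_coercive[OF B[OF S(2)]] by blast
  \<comment> \<open>\<open>b q\<close> is the residual of the solution at \<open>p\<close> in the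
    system at \<open>q\<close>, and \<open>c q\<close> measures how far \<open>B q\<close> is from
    \<open>B p\<close>; both tend to 0. Testing the system at \<open>q\<close> with
    \<open>a q - a p\<close> gives \<open>est\<close>, where the coercivity constant
    \<open>m\<close> is lowered by \<open>c q\<close>.\<close>
  define b where "b q = (\<Sum>i\<in>Basis. \<bar>\<phi> q i - B q (a p) i\<bar>)" for q
  define c where "c q = (\<Sum>i\<in>Basis. \<Sum>j\<in>Basis. \<bar>B p i j - B q i j\<bar>)" for q
  have lin_bound: "\<bar>\<psi> z\<bar> \<le> (\<Sum>i\<in>Basis. \<bar>\<psi> i\<bar>) * norm z" if "linear \<psi>" for \<psi> :: "'e \<Rightarrow> real" and z
  proof -
    have "\<psi> z = \<psi> (\<Sum>i\<in>Basis. (z \<bullet> i) *\<^sub>R i)" by (simp add: euclidean_representation)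
    then have "\<psi> z = (\<Sum>i\<in>Basis. (z \<bullet> i) * \<psi> i)" using that by (simp add: linear_sum linear_cmul)
    also have "\<bar>\<dots>\<bar> \<le> (\<Sum>i\<in>Basis. \<bar>(z \<bullet> i) * \<psi> i\<bar>)" by (rule sum_abs)
    also have "\<dots> \<le> (\<Sum>i\<in>Basis. norm z * \<bar>\<psi> i\<bar>)"
      unfolding abs_mult by (intro sum_mono mult_right_mono) (auto simp: Basis_le_norm)
    finally show ?thesis by (simp add: sum_distrib_left[symmetric] mult.commute)
  qed
  have bil_bound: "\<bar>B p v w - B q v w\<bar> \<le> c q * norm v * norm w" if q: "q \<in> S" for q v w
  proof -
    have "\<bar>B p v w - B q v w\<bar> \<le> (\<Sum>j\<in>Basis. \<bar>B p v j - B q v j\<bar>) * norm w"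
      by (rule lin_bound[of "\<lambda>w. B p v w - B q v w"])
        (use bil[OF q] bil[OF S(2)] in \<open>auto simp: bilinear_def intro: linear_compose_sub\<close>)
    also have "(\<Sum>j\<in>Basis. \<bar>B p v j - B q v j\<bar>) \<le> (\<Sum>j\<in>Basis. (\<Sum>i\<in>Basis. \<bar>B p i j - B q i j\<bar>) * norm v)"
      by (intro sum_mono lin_bound[of "\<lambda>v. B p v _ - B q v _"])
        (use bil[OF q] bil[OF S(2)] in \<open>auto simp: bilinear_def intro: linear_compose_sub\<close>)
    also have "\<dots> = c q * norm v"
      unfolding c_def by (subst sum.swap) (simp add: sum_distrib_right)
    finally show ?thesis by (simp add: mult_right_mono)
  qed
  have est: "(m - c q) * norm (a q - a p) \<le> b q" if q: "q \<in> S" for q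
  proof (cases "a q = a p")
    case True then show ?thesis by (auto simp: b_def intro: sum_nonneg)
  next
    case False
    define w where "w = a q - a p"
    have "B q w w = \<phi> q w - B q (a p) w"
      using a[OF q, of w] bil[OF q] by (simp add: w_def bilinear_lsub)
    also have "\<dots> \<le> b q * norm w"
      using lin_bound[of "\<lambda>z. \<phi> q z - B q (a p) z" w] lin[OF q] bil[OF q]
      by (auto simp: b_def bilinear_def linear_compose_sub)
    finally have "B q w w \<le> b q * norm w" .
    moreover have "m * (norm w)\<^sup>2 - c q * norm w * norm w \<le> B q w w"
      using m(2)[of w] bil_bound[OF q, of w w] by linarith
    ultimately have "((m - c q) * norm w) * norm w \<le> b q * norm w"
      by (simp add: power2_eq_square algebra_simps)
    then show ?thesis using False by (simp add: w_def)
  qed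
  have b0: "b \<midarrow>p\<rightarrow> 0"
  proof -
    have "isCont b p" unfolding b_def by (intro continuous_intros Bc \<phi>c)
    then show ?thesis using a[OF S(2)] by (simp add: isCont_def b_def)
  qed
  have c0: "c \<midarrow>p\<rightarrow> 0"
  proof -
    have "isCont c p" unfolding c_def by (intro continuous_intros Bc)
    then show ?thesis by (simp add: isCont_def c_def)
  qed
  have "eventually (\<lambda>q. norm (a q - a p) \<le> b q / (m - c q)) (at p)"
  proof -
    have "eventually (\<lambda>q. c q < m) (at p)" using c0 m(1) by (rule order_tendstoD)
    moreover have "eventually (\<lambda>q. q \<in> S) (at p)" using S by (simp add: eventually_at_in_open')
    ultimately show ?thesis
    proof eventually_elim
      case (elim q)
      then show ?case using est[of q] by (simp add: pos_le_divide_eq mult.commute)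
    qed
  qed
  moreover have "((\<lambda>q. b q / (m - c q)) \<longlongrightarrow> 0 / (m - 0)) (at p)"
    by (intro tendsto_intros b0 c0) (use m in simp)
  ultimately have "((\<lambda>q. a q - a p) \<longlongrightarrow> 0) (at p)"
    using Lim_null_comparison by fastforce
  then show ?thesis unfolding isCont_def a_def by (simp add: LIM_zero_cancel)
qed

lemma raise_linear:
  fixes B :: "'e::euclidean_space \<Rightarrow> 'e \<Rightarrow> real"
  assumes B: "pos_definite B"
    and \<phi>: "\<And>u. linear (\<phi> u)" and add: "\<And>u v z. \<phi> (u + v) z = \<phi> u z + \<phi> v z"
    and scale: "\<And>r u z. \<phi> (r *\<^sub>R u) z = r * \<phi> u z"
  shows "linear (\<lambda>u. raise B (\<phi> u))"
proof -
  have bil: "bilinear B" using B by (simp add: pos_definite_def)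
  show ?thesis
    by (intro linearI raise_eqI[OF B])
      (simp_all add: bilinear_ladd[OF bil] bilinear_lmul[OF bil] raise[OF B \<phi>] add scale)
qed

text \<open>With \<open>a q\<close> the solution, \<open>B p (a q - a p) = (\<phi> q - \<phi> p) - (B q - B p) (a q)\<close>, whose right-hand
  side is differentiable at \<open>p\<close> as soon as \<open>a\<close> is continuous there.\<close>

lemma raise_differentiable:
  fixes B :: "'p::real_normed_vector \<Rightarrow> 'e::euclidean_space \<Rightarrow> 'e \<Rightarrow> real"
  assumes S: "open S" "p \<in> S" and B: "\<And>q. q \<in> S \<Longrightarrow> pos_definite (B q)"
    and lin: "\<And>q. q \<in> S \<Longrightarrow> linear (\<phi> q)"
    and Bd: "\<And>v w. (\<lambda>q. B q v w) differentiable (at p)"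
    and \<phi>d: "\<And>z. (\<lambda>q. \<phi> q z) differentiable (at p)"
  shows "(\<lambda>q. raise (B q) (\<phi> q)) differentiable (at p)"
proof -
  define a where "a q = raise (B q) (\<phi> q)" for q
  have a: "B q (a q) z = \<phi> q z" if "q \<in> S" for q z
    unfolding a_def by (rule raise[OF B lin]) (use that in auto)
  have bil: "bilinear (B q)" if "q \<in> S" for q using B[OF that] by (simp add: pos_definite_def)
  have acont: "isCont a p"
    unfolding a_def using Bd \<phi>d
    by (intro raise_isCont[OF S B lin]) (auto intro: differentiable_imp_continuous_within)
  \<comment> \<open>If one factor is differentiable and vanishes at \<open>p\<close>, continuity of
    the other suffices, the derivative being \<open>f' d * g p\<close>. This breaks the circularity
    that the right-hand side contains \<open>a\<close>, so far known only to be continuous.\<close>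
  have prod: "(\<lambda>q. f q * (g q :: real)) differentiable (at p)"
    if fd: "f differentiable (at p)" and f0: "f p = 0" and gc: "isCont g p" for f g
  proof -
    obtain f' where f': "(f has_derivative f') (at p)" using fd unfolding differentiable_def by blast
    have lim: "((\<lambda>q. norm (f q - f p - f' (q - p)) / norm (q - p)) \<longlongrightarrow> 0) (at p)"
      using f' unfolding has_derivative_iff_norm by blast
    obtain K where K: "\<And>v. norm (f' v) \<le> norm v * K" "K > 0"
      using bounded_linear.pos_bounded[OF has_derivative_bounded_linear[OF f']] by blast
    have g0: "((\<lambda>q. \<bar>g q - g p\<bar>) \<longlongrightarrow> 0) (at p)"
      using gc by (simp add: isCont_def LIM_zero tendsto_rabs_zero)
    have "((\<lambda>q. f q * g q) has_derivative (\<lambda>d. f' d * g p)) (at p)"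
      unfolding has_derivative_iff_norm
    proof
      show "bounded_linear (\<lambda>d. f' d * g p)"
        by (rule bounded_linear_mult_const[OF has_derivative_bounded_linear[OF f']])
      have t: "((\<lambda>q. norm (f q - f p - f' (q - p)) / norm (q - p) * \<bar>g q\<bar> + K * \<bar>g q - g p\<bar>)
        \<longlongrightarrow> 0 * \<bar>g p\<bar> + K * 0) (at p)"
        by (intro tendsto_intros lim g0) (use gc in \<open>simp add: isCont_def\<close>)
      have ev: "eventually (\<lambda>q. norm (norm (f q * g q - f p * g p - f' (q - p) * g p) / norm (q - p))
          \<le> norm (f q - f p - f' (q - p)) / norm (q - p) * \<bar>g q\<bar> + K * \<bar>g q - g p\<bar>) (at p)"
        unfolding eventually_at_filter
      proof (rule always_eventually, intro allI impI)
        fix q assume "q \<noteq> p"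
        then have n: "norm (q - p) > 0" by simp
        have "f q * g q - f p * g p - f' (q - p) * g p
            = (f q - f p - f' (q - p)) * g q + f' (q - p) * (g q - g p)"
          using f0 by (simp add: algebra_simps)
        then have "\<bar>f q * g q - f p * g p - f' (q - p) * g p\<bar>
            \<le> \<bar>f q - f p - f' (q - p)\<bar> * \<bar>g q\<bar> + (norm (q - p) * K) * \<bar>g q - g p\<bar>"
          using abs_triangle_ineq[of "(f q - f p - f' (q - p)) * g q" "f' (q - p) * (g q - g p)"]
            mult_right_mono[OF K(1)[of "q - p"], of "\<bar>g q - g p\<bar>"]
          by (simp add: abs_mult)
        then show "norm (norm (f q * g q - f p * g p - f' (q - p) * g p) / norm (q - p))
          \<le> norm (f q - f p - f' (q - p)) / norm (q - p) * \<bar>g q\<bar> + K * \<bar>g q - g p\<bar>"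
          using n by (simp add: field_simps)
      qed
      show "((\<lambda>q. norm (f q * g q - f p * g p - f' (q - p) * g p) / norm (q - p)) \<longlongrightarrow> 0) (at p)"
        by (rule Lim_null_comparison[OF ev]) (use t in simp)
    qed
    then show ?thesis unfolding differentiable_def by blast
  qed
  \<comment> \<open>The solution operator of the fixed form \<open>B p\<close>, applied to
    coordinate vectors. It is linear, so only differentiability of the right-hand side \<psi>
    remains to be shown.\<close>
  define L where "L \<psi> = raise (B p) (\<lambda>z. \<Sum>i\<in>Basis. (z \<bullet> i) * (\<psi> \<bullet> i))" for \<psi> :: 'e
  have linL: "linear L"
    unfolding L_def
    by (rule raise_linear[OF B[OF S(2)]])
      (auto intro!: linearI simp: inner_add_left algebra_simps sum.distrib sum_distrib_left)
  define \<psi> where "\<psi> q = (\<Sum>i\<in>Basis. (\<phi> q i - \<phi> p i - (\<Sum>j\<in>Basis. (B q j i - B p j i) * (a q \<bullet> j))) *\<^sub>R i)" for q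
  have \<psi>d: "\<psi> differentiable (at p)"
    unfolding \<psi>_def
    by (intro derivative_intros differentiable_sum finite_Basis prod ballI \<phi>d Bd continuous_intros acont) auto
  have key: "a q = a p + L (\<psi> q)" if q: "q \<in> S" for q
  proof -
    have Bexp: "B r v z = (\<Sum>i\<in>Basis. \<Sum>j\<in>Basis. (z \<bullet> i) * ((v \<bullet> j) * B r j i))" if "r \<in> S" for r v z
    proof -
      have "B r v z = B r (\<Sum>j\<in>Basis. (v \<bullet> j) *\<^sub>R j) (\<Sum>i\<in>Basis. (z \<bullet> i) *\<^sub>R i)"
        by (simp add: euclidean_representation)
      also have "\<dots> = (\<Sum>j\<in>Basis. \<Sum>i\<in>Basis. (z \<bullet> i) * ((v \<bullet> j) * B r j i))"
        by (simp add: bilinear_sum[OF bil[OF that]] bilinear_lmul[OF bil[OF that]]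
          bilinear_rmul[OF bil[OF that]] sum.cartesian_product ac_simps)
      also have "\<dots> = (\<Sum>i\<in>Basis. \<Sum>j\<in>Basis. (z \<bullet> i) * ((v \<bullet> j) * B r j i))"
        by (rule sum.swap)
      finally show ?thesis .
    qed
    have \<phi>exp: "\<phi> r z = (\<Sum>i\<in>Basis. (z \<bullet> i) * \<phi> r i)" if "r \<in> S" for r z
    proof -
      have "\<phi> r z = \<phi> r (\<Sum>i\<in>Basis. (z \<bullet> i) *\<^sub>R i)" by (simp add: euclidean_representation)
      then show ?thesis using lin[OF that] by (simp add: linear_sum linear_cmul)
    qed
    have \<psi>i: "\<psi> q \<bullet> i = \<phi> q i - \<phi> p i - (\<Sum>j\<in>Basis. (B q j i - B p j i) * (a q \<bullet> j))"
      if "i \<in> Basis" for i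
      using that by (simp add: \<psi>_def)
    have "L (\<psi> q) = a q - a p"
      unfolding L_def
    proof (rule raise_eqI[OF B[OF S(2)]])
      fix z
      have "B p (a q - a p) z = \<phi> q z - \<phi> p z - (B q (a q) z - B p (a q) z)"
        using a[OF q, of z] a[OF S(2), of z] by (simp add: bilinear_lsub[OF bil[OF S(2)]])
      also have "\<dots> = (\<Sum>i\<in>Basis. (z \<bullet> i) * (\<psi> q \<bullet> i))"
        unfolding Bexp[OF q, of "a q" z] Bexp[OF S(2), of "a q" z] \<phi>exp[OF q, of z] \<phi>exp[OF S(2), of z]
        by (simp add: \<psi>i sum_subtractf[symmetric] sum_distrib_left algebra_simps)
      finally show "B p (a q - a p) z = (\<Sum>i\<in>Basis. (z \<bullet> i) * (\<psi> q \<bullet> i))" .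
    qed
    then show ?thesis by simp
  qed
  have "(\<lambda>q. a p + L (\<psi> q)) differentiable (at p)"
    by (intro derivative_intros differentiable_compose[of L, OF _ \<psi>d]
      linear_imp_differentiable[OF linL])
  then have "a differentiable (at p)"
    by (rule differentiable_cong_open[OF _ S]) (simp add: key)
  then show ?thesis unfolding a_def .
qed

section \<open>Riemannian metrics on an open set\<close>

lemma frechet_derivative_eqI: "(f has_derivative f') (at x) \<Longrightarrow> frechet_derivative f (at x) = f'"
  by (rule frechet_derivative_at[symmetric])

lemma pos_definite_nonneg:
  assumes "pos_definite B" shows "0 \<le> B v v"
  using assms by (cases "v = 0") (auto simp: pos_definite_def bilinear_lzero less_imp_le)

text \<open>The vector \<open>B w w u - B u w w\<close> is the component of \<open>u\<close> orthogonal to \<open>w\<close>, up to a factor.\<close>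

lemma gram_det_identity:
  assumes B: "bilinear B" and sym: "\<And>v w. B v w = (B w v :: real)"
  shows "B (B w w *\<^sub>R u - B u w *\<^sub>R w) (B w w *\<^sub>R u - B u w *\<^sub>R w) = B w w * (B w w * B u u - (B u w)\<^sup>2)"
  using sym[of w u]
  by (simp add: bilinear_lsub[OF B] bilinear_rsub[OF B] bilinear_lmul[OF B] bilinear_rmul[OF B]
    power2_eq_square algebra_simps)

lemma gram_det_nonneg:
  assumes B: "pos_definite B" and sym: "\<And>v w. B v w = (B w v :: real)"
  shows "0 \<le> B w w * B u u - (B u w)\<^sup>2"
proof (cases "w = 0")
  case True
  then show ?thesis using B by (simp add: pos_definite_def bilinear_lzero bilinear_rzero)
next
  case False
  have "bilinear B" "B w w > 0" using B False by (auto simp: pos_definite_def)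
  moreover have "0 \<le> B w w * (B w w * B u u - (B u w)\<^sup>2)"
    using gram_det_identity[OF \<open>bilinear B\<close> sym, of w u] pos_definite_nonneg[OF B] by metis
  ultimately show ?thesis by (simp add: zero_le_mult_iff)
qed

text \<open>The equality case of the Cauchy-Schwarz inequality, with denominators cleared.\<close>

lemma gram_det_eq_0:
  assumes B: "pos_definite B" and sym: "\<And>v w. B v w = (B w v :: real)"
    and 0: "B w w * B u u - (B u w)\<^sup>2 = 0"
  shows "B w w *\<^sub>R u = B u w *\<^sub>R w"
proof (rule ccontr)
  assume "\<not> ?thesis"
  then have "B w w *\<^sub>R u - B u w *\<^sub>R w \<noteq> 0" by simp
  then have "0 < B (B w w *\<^sub>R u - B u w *\<^sub>R w) (B w w *\<^sub>R u - B u w *\<^sub>R w)"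
    using B by (simp add: pos_definite_def)
  moreover have "bilinear B" using B by (simp add: pos_definite_def)
  ultimately show False using gram_det_identity[of B w u] sym 0 by simp
qed

lemma dim_2_not_parallel:
  fixes u w :: "'e::euclidean_space"
  assumes "dim (span {u, w}) = 2"
  shows "w \<noteq> 0" and "u \<noteq> k *\<^sub>R w"
proof -
  have *: "span {u, w} \<noteq> span {a}" for a
  proof
    assume "span {u, w} = span {a}"
    moreover have "dim (span {a}) \<le> 1" using dim_le_card'[of "{a}"] by simp
    ultimately show False using assms by simp
  qed
  show "w \<noteq> 0" using *[of u] by (auto simp: insert_commute)
  have "u \<in> span {w} \<Longrightarrow> span {u, w} = span {w}" by (simp add: span_redundant)
  then show "u \<noteq> k *\<^sub>R w" using *[of w] by (auto simp: span_base span_scale)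
qed

lemma gram_det_pos:
  fixes u w :: "'e::euclidean_space"
  assumes B: "pos_definite B" and sym: "\<And>v w. B v w = (B w v :: real)"
    and dim: "dim (span {u, w}) = 2"
  shows "0 < B w w * B u u - (B u w)\<^sup>2"
proof (rule ccontr)
  assume "\<not> ?thesis"
  then have "B w w * B u u - (B u w)\<^sup>2 = 0" using gram_det_nonneg[OF B sym, of w u] by simp
  then have "B w w *\<^sub>R u = B u w *\<^sub>R w" by (rule gram_det_eq_0[OF B sym])
  moreover have "B w w > 0" using B dim_2_not_parallel(1)[OF dim] by (simp add: pos_definite_def)
  ultimately have "u = (B u w / B w w) *\<^sub>R w"
    by (metis divide_inverse_commute inverse_inverse_eq less_irrefl left_inverse scaleR_one scaleR_scaleR)
  then show False using dim_2_not_parallel(2)[OF dim] by blast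
qed

locale riemannian_domain =
  fixes S :: "'e::euclidean_space set" and h :: "'e \<Rightarrow> 'e \<Rightarrow> 'e \<Rightarrow> real"
  assumes open_S: "open S"
    and pos_definite: "x \<in> S \<Longrightarrow> pos_definite (h x)"
    and sym: "x \<in> S \<Longrightarrow> h x v w = h x w v"
    and smooth: "smooth_on S (\<lambda>x. h x v w)"
begin

abbreviation dh :: "'e \<Rightarrow> 'e \<Rightarrow> 'e \<Rightarrow> 'e \<Rightarrow> real" where
  "dh x v w \<equiv> frechet_derivative (\<lambda>x. h x v w) (at x)"

abbreviation \<Gamma> :: "'e \<Rightarrow> 'e \<Rightarrow> 'e \<Rightarrow> 'e" where
  "\<Gamma> \<equiv> levi_civita h"

abbreviation d\<Gamma> :: "'e \<Rightarrow> 'e \<Rightarrow> 'e \<Rightarrow> 'e \<Rightarrow> 'e" where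
  "d\<Gamma> x u w \<equiv> frechet_derivative (\<lambda>x. \<Gamma> x u w) (at x)"

abbreviation Rm :: "'e \<Rightarrow> 'e \<Rightarrow> 'e \<Rightarrow> 'e \<Rightarrow> 'e" where
  "Rm \<equiv> riemann_curvature h"

lemma bilinear_h: "x \<in> S \<Longrightarrow> bilinear (h x)"
  using pos_definite by (simp add: pos_definite_def)

lemmas h_add = bilinear_h[THEN bilinear_ladd] bilinear_h[THEN bilinear_radd]
lemmas h_sub = bilinear_h[THEN bilinear_lsub] bilinear_h[THEN bilinear_rsub]
lemmas h_scale = bilinear_h[THEN bilinear_lmul] bilinear_h[THEN bilinear_rmul]
lemmas h_neg = bilinear_h[THEN bilinear_lneg] bilinear_h[THEN bilinear_rneg]

lemma h_derivative: "x \<in> S \<Longrightarrow> ((\<lambda>x. h x v w) has_derivative dh x v w) (at x)"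
  using smooth[of v w, unfolded smooth_on_def, rule_format, of "Suc 0"]
  by (simp add: frechet_derivative_works)

lemma dh_differentiable: "x \<in> S \<Longrightarrow> (\<lambda>x. dh x v w u) differentiable (at x)"
  using smooth[of v w, unfolded smooth_on_def, rule_format, of "Suc (Suc 0)"] by simp

lemma linear_dh: "x \<in> S \<Longrightarrow> linear (dh x v w)"
  using h_derivative has_derivative_linear by blast

lemma dh_sym: "x \<in> S \<Longrightarrow> dh x v w = dh x w v"
  by (rule frechet_derivative_eqI, rule has_derivative_cong_open[OF h_derivative open_S]) (auto simp: sym)

lemma bilinear_dh:
  assumes x: "x \<in> S" shows "bilinear (\<lambda>v w. dh x v w u)"
proof -
  have add: "dh x (v + v') w = (\<lambda>u. dh x v w u + dh x v' w u)" for v v' w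
    by (rule frechet_derivative_eqI, rule has_derivative_cong_open[OF _ open_S x])
      (auto intro!: has_derivative_add h_derivative x simp: h_add)
  have scale: "dh x (k *\<^sub>R v) w = (\<lambda>u. k * dh x v w u)" for k v w
    by (rule frechet_derivative_eqI, rule has_derivative_cong_open[OF _ open_S x])
      (auto intro!: has_derivative_mult_right h_derivative x simp: h_scale)
  show ?thesis
    unfolding bilinear_def
    by (auto intro!: linearI simp: add scale dh_sym[OF x, of _ "_ + _"] dh_sym[OF x, of _ "_ *\<^sub>R _"]
      dh_sym[OF x, of _ _])
qed

lemmas dh_add = bilinear_dh[THEN bilinear_ladd] bilinear_dh[THEN bilinear_radd]
  linear_dh[THEN linear_add]
lemmas dh_scale = bilinear_dh[THEN bilinear_lmul] bilinear_dh[THEN bilinear_rmul]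
  linear_dh[THEN linear_cmul]

lemma linear_koszul:
  assumes x: "x \<in> S"
  shows "linear (\<lambda>z. (1/2) * (dh x w z u + dh x u z w - dh x u w z))"
  by (rule linearI) (simp_all add: dh_add[OF x] dh_scale[OF x] algebra_simps)

lemma h_levi_civita:
  assumes x: "x \<in> S"
  shows "h x (\<Gamma> x u w) z = (1/2) * (dh x w z u + dh x u z w - dh x u w z)"
  unfolding levi_civita_def by (rule raise[OF pos_definite[OF x] linear_koszul[OF x]])

lemma \<Gamma>_sym: "x \<in> S \<Longrightarrow> \<Gamma> x u w = \<Gamma> x w u"
  by (rule pos_definite_eqI[OF pos_definite]) (auto simp: h_levi_civita dh_sym)

lemma bilinear_\<Gamma>:
  assumes x: "x \<in> S" shows "bilinear (\<Gamma> x)"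
proof -
  have "linear (\<lambda>w. \<Gamma> x u w)" for u
    by (intro linearI pos_definite_eqI[OF pos_definite[OF x]])
      (simp_all add: h_levi_civita[OF x] h_add[OF x] h_scale[OF x] dh_add[OF x] dh_scale[OF x] algebra_simps)
  then show ?thesis unfolding bilinear_def using \<Gamma>_sym[OF x] by simp
qed

lemmas \<Gamma>_add = bilinear_\<Gamma>[THEN bilinear_ladd] bilinear_\<Gamma>[THEN bilinear_radd]
lemmas \<Gamma>_scale = bilinear_\<Gamma>[THEN bilinear_lmul] bilinear_\<Gamma>[THEN bilinear_rmul]
lemmas \<Gamma>_neg = bilinear_\<Gamma>[THEN bilinear_lneg] bilinear_\<Gamma>[THEN bilinear_rneg]

lemma metric_compatible:
  assumes x: "x \<in> S"
  shows "dh x v w u = h x (\<Gamma> x u v) w + h x v (\<Gamma> x u w)"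
  by (simp add: sym[OF x, of v] h_levi_civita[OF x] dh_sym[OF x, of w v] field_simps)

text \<open>\<Gamma> solves a linear system with coefficients \<open>h\<close> and right-hand side
  built from \<open>dh\<close>; both are differentiable, and \<open>raise_differentiable\<close>
  passes this on to the solution.\<close>

lemma \<Gamma>_derivative:
  assumes x: "x \<in> S" shows "((\<lambda>x. \<Gamma> x u w) has_derivative d\<Gamma> x u w) (at x)"
  unfolding frechet_derivative_works[symmetric] levi_civita_def
  by (rule raise_differentiable[OF open_S x pos_definite linear_koszul])
    (auto intro!: derivative_intros dh_differentiable x differentiableI[OF h_derivative[OF x]])

lemma linear_d\<Gamma>: "x \<in> S \<Longrightarrow> linear (d\<Gamma> x u w)"
  using \<Gamma>_derivative has_derivative_linear by blast

lemma d\<Gamma>_sym: "x \<in> S \<Longrightarrow> d\<Gamma> x u w = d\<Gamma> x w u"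
  by (rule frechet_derivative_eqI, rule has_derivative_cong_open[OF \<Gamma>_derivative open_S])
    (auto simp: \<Gamma>_sym)

lemma bilinear_d\<Gamma>:
  assumes x: "x \<in> S" shows "bilinear (\<lambda>u w. d\<Gamma> x u w d)"
proof -
  have add: "d\<Gamma> x (v + v') w = (\<lambda>u. d\<Gamma> x v w u + d\<Gamma> x v' w u)" for v v' w
    by (rule frechet_derivative_eqI, rule has_derivative_cong_open[OF _ open_S x])
      (auto intro!: has_derivative_add \<Gamma>_derivative x simp: \<Gamma>_add)
  have scale: "d\<Gamma> x (k *\<^sub>R v) w = (\<lambda>u. k *\<^sub>R d\<Gamma> x v w u)" for k v w
    by (rule frechet_derivative_eqI, rule has_derivative_cong_open[OF _ open_S x])
      (auto intro!: has_derivative_scaleR_right \<Gamma>_derivative x simp: \<Gamma>_scale)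
  show ?thesis
    unfolding bilinear_def
    by (auto intro!: linearI simp: add scale d\<Gamma>_sym[OF x, of _ "_ + _"] d\<Gamma>_sym[OF x, of _ "_ *\<^sub>R _"]
      d\<Gamma>_sym[OF x, of _ _])
qed

lemmas d\<Gamma>_add = bilinear_d\<Gamma>[THEN bilinear_ladd] bilinear_d\<Gamma>[THEN bilinear_radd]
  linear_d\<Gamma>[THEN linear_add]
lemmas d\<Gamma>_scale = bilinear_d\<Gamma>[THEN bilinear_lmul] bilinear_d\<Gamma>[THEN bilinear_rmul]
  linear_d\<Gamma>[THEN linear_cmul]

section \<open>Curvature of the Levi-Civita connection\<close>

lemma Rm_eq:
  assumes x: "x \<in> S"
  shows "Rm x u w z = d\<Gamma> x w z u + \<Gamma> x u (\<Gamma> x w z) - (d\<Gamma> x u z w + \<Gamma> x w (\<Gamma> x u z))"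
  by (simp add: riemann_curvature_def levi_civita_deriv_def[abs_def])

lemma Rm_antisym: "x \<in> S \<Longrightarrow> Rm x u w z = - Rm x w u z"
  by (simp add: Rm_eq)

lemma linear_Rm:
  assumes x: "x \<in> S"
  shows "linear (\<lambda>u. Rm x u w z)" "linear (\<lambda>w. Rm x u w z)" "linear (\<lambda>z. Rm x u w z)"
  by (auto intro!: linearI simp: Rm_eq x d\<Gamma>_add d\<Gamma>_scale \<Gamma>_add \<Gamma>_scale algebra_simps)

text \<open>Metric compatibility absorbs the derivative of \<open>h\<close> into covariant
  derivatives of the arguments. The base point is an arbitrary map \<open>p\<close>, so that the
  same rule serves derivatives in \<open>x\<close> and joint derivatives in \<open>(x, y)\<close>.
  \<open>\<omega>_covariant_derivative\<close> is its analogue, with \<open>r\<close> as the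
  defect.\<close>

lemma h_covariant_derivative:
  assumes p: "(p :: 'p::real_normed_vector \<Rightarrow> 'e) q \<in> S" and dp: "(p has_derivative p') (at q)"
    and a: "(a has_derivative a') (at q)" and b: "(b has_derivative b') (at q)"
  shows "((\<lambda>r. h (p r) (a r) (b r)) has_derivative
    (\<lambda>d. h (p q) (a' d + \<Gamma> (p q) (p' d) (a q)) (b q) + h (p q) (a q) (b' d + \<Gamma> (p q) (p' d) (b q)))) (at q)"
proof -
  obtain V where V: "open V" "q \<in> V" "\<And>r. r \<in> V \<Longrightarrow> p r \<in> S"
    using continuous_at_open[THEN iffD1, OF has_derivative_continuous[OF dp]] open_S p by metis
  have "((\<lambda>r. h (p r) v w) has_derivative
      (\<lambda>d. h (p q) (\<Gamma> (p q) (p' d) v) w + h (p q) v (\<Gamma> (p q) (p' d) w))) (at q)" for v w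
    using has_derivative_compose[OF dp h_derivative[OF p]] unfolding metric_compatible[OF p] .
  from bilinear_family_has_derivative[where B = "\<lambda>r. h (p r)", OF V(1,2) bilinear_h[OF V(3)] this a b]
  show ?thesis
    by (rule has_derivative_eq_rhs) (simp_all add: h_add[OF p] algebra_simps)
qed

text \<open>The second derivative of \<open>h z z\<close> is symmetric.\<close>

lemma h_Rm_self:
  assumes x: "x \<in> S" shows "h x (Rm x u w z) z = 0"
proof -
  have 1: "((\<lambda>x. h x z z) has_derivative (\<lambda>u. 2 * h x (\<Gamma> x u z) z)) (at x)" if "x \<in> S" for x
    by (rule has_derivative_eq_rhs[OF h_derivative[OF that]])
      (simp add: fun_eq_iff metric_compatible[OF that] sym[OF that, of z])
  have 2: "((\<lambda>x. 2 * h x (\<Gamma> x u z) z) has_derivative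
    (\<lambda>w. 2 * (h x (d\<Gamma> x u z w + \<Gamma> x w (\<Gamma> x u z)) z + h x (\<Gamma> x u z) (0 + \<Gamma> x w z)))) (at x)" for u
    by (intro has_derivative_mult_right h_covariant_derivative[where p = "\<lambda>x. x"] has_derivative_ident
      \<Gamma>_derivative has_derivative_const x)
  from symmetric_second_derivative[OF open_S x 1 2 2, of w u] show ?thesis
    using sym[OF x, of "\<Gamma> x u z"] by (simp add: Rm_eq[OF x] h_sub[OF x] h_add[OF x])
qed

lemma h_Rm_antisym:
  assumes x: "x \<in> S" shows "h x (Rm x u w z) v = - h x (Rm x u w v) z"
  using h_Rm_self[OF x, of u w "z + v"]
  by (simp add: linear_add[OF linear_Rm(3)[OF x]] h_add[OF x] h_Rm_self[OF x])

lemma sectional_curvature_eq: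
  assumes x: "x \<in> S" and dim: "dim (span {u, w}) = 2"
  shows "sectional_curvature h x (span {u, w}) =
    h x (Rm x u w w) u / (h x w w * h x u u - (h x w u)\<^sup>2)"
  unfolding sectional_curvature_def
proof (rule the_equality)
  let ?k = "\<lambda>u w. h x (Rm x u w w) u / (h x w w * h x u u - (h x w u)\<^sup>2)"
  show "\<forall>u' w'. span {u, w} = span {u', w'} \<longrightarrow> ?k u w = ?k u' w'"
  proof (intro allI impI)
    fix u' w' assume eq: "span {u, w} = span {u', w'}"
    have "u' \<in> span {u, w}" "w' \<in> span {u, w}" by (simp_all add: eq span_base)
    then obtain a b c d where "u' - a *\<^sub>R u = b *\<^sub>R w" "w' - c *\<^sub>R u = d *\<^sub>R w"
      unfolding span_insert[of u] span_singleton by blast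
    then have u': "u' = a *\<^sub>R u + b *\<^sub>R w" and w': "w' = c *\<^sub>R u + d *\<^sub>R w"
      by (simp_all add: algebra_simps)
    \<comment> \<open>Determinant of the base change: numerator and denominator both scale by
      \<open>D\<^sup>2\<close>, and positivity of the new Gram determinant excludes
      \<open>D = 0\<close>.\<close>
    define D where "D = a * d - b * c"
    have "h x w' w' * h x u' u' - (h x w' u')\<^sup>2 = D\<^sup>2 * (h x w w * h x u u - (h x w u)\<^sup>2)"
      unfolding u' w' D_def using sym[OF x, of w u]
      by (simp add: h_add[OF x] h_scale[OF x] power2_eq_square algebra_simps)
    moreover have "h x w' w' * h x u' u' - (h x w' u')\<^sup>2 > 0"
      using gram_det_pos[OF pos_definite[OF x] sym[OF x], of u' w'] dim eq sym[OF x, of w' u'] by simp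
    moreover have "Rm x u' w' = (\<lambda>z. D *\<^sub>R Rm x u w z)"
    proof
      fix z
      have "Rm x u u z = 0" "Rm x w w z = 0" by (simp_all add: Rm_eq x)
      then show "Rm x u' w' z = D *\<^sub>R Rm x u w z"
        using Rm_antisym[OF x, of w u z]
        by (simp add: u' w' linear_add[OF linear_Rm(1)[OF x]] linear_cmul[OF linear_Rm(1)[OF x]]
          linear_add[OF linear_Rm(2)[OF x]] linear_cmul[OF linear_Rm(2)[OF x]] D_def algebra_simps)
    qed
    then have "h x (Rm x u' w' w') u' = D\<^sup>2 * h x (Rm x u w w) u"
      using h_Rm_antisym[OF x, of u w u w]
      by (simp add: u' w' linear_add[OF linear_Rm(3)[OF x]] linear_cmul[OF linear_Rm(3)[OF x]]
        h_add[OF x] h_sub[OF x] h_scale[OF x] h_Rm_self[OF x] D_def power2_eq_square algebra_simps)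
    ultimately show "?k u w = ?k u' w'" by (auto simp: zero_less_mult_iff)
  qed
  then show "k = ?k u w" if "\<forall>u' w'. span {u, w} = span {u', w'} \<longrightarrow> k = ?k u' w'" for k
    using that by blast
qed

end

section \<open>A Randers metric with closed one-form\<close>

lemma has_derivative_partial:
  assumes "((\<lambda>p. f (fst p) (snd p)) has_derivative D) (at (x, y))"
  shows "((\<lambda>x. f x y) has_derivative (\<lambda>d. D (d, 0))) (at x)"
    "(f x has_derivative (\<lambda>d. D (0, d))) (at y)"
proof -
  have "((\<lambda>x. (x, y)) has_derivative (\<lambda>d. (d, 0))) (at x)"
    "((\<lambda>y. (x, y)) has_derivative (\<lambda>d. (0, d))) (at y)"
    by (auto intro!: derivative_eq_intros)
  from this[THEN has_derivative_compose, OF assms]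
  show "((\<lambda>x. f x y) has_derivative (\<lambda>d. D (d, 0))) (at x)"
    "(f x has_derivative (\<lambda>d. D (0, d))) (at y)"
    by simp_all
qed

text \<open>By linearity the two partial derivatives merge into one joint derivative in the
  direction of the horizontal lift. This is the reason for differentiating everything jointly in
  \<open>(x, y)\<close>.\<close>

lemma horizontal_deriv_eq:
  assumes "((\<lambda>p. f (fst p) (snd p)) has_derivative D) (at (x, y))"
  shows "horizontal_deriv F u f x y = D (u, - nonlinear_connection F x y u)"
proof -
  have "horizontal_deriv F u f x y = D (u, 0) - D (0, nonlinear_connection F x y u)"
    using has_derivative_partial[OF assms] by (simp add: horizontal_deriv_def frechet_derivative_eqI)
  also have "\<dots> = D ((u, 0) - (0, nonlinear_connection F x y u))"
    by (rule linear_diff[symmetric]) (use assms has_derivative_linear in blast)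
  finally show ?thesis by simp
qed

lemma deriv_along_line:
  fixes f :: "'a::real_normed_vector \<Rightarrow> real"
  assumes f: "(f has_derivative f') (at z)"
  shows "deriv (\<lambda>t. f (z + t *\<^sub>R v)) 0 = f' v"
proof (rule DERIV_imp_deriv)
  have "((\<lambda>t. z + t *\<^sub>R v) has_derivative (\<lambda>t. t *\<^sub>R v)) (at 0)"
    by (auto intro!: derivative_eq_intros)
  from has_derivative_compose[OF this, of f f'] f
  have "((\<lambda>t. f (z + t *\<^sub>R v)) has_derivative (\<lambda>t. f' (t *\<^sub>R v))) (at 0)" by simp
  then show "((\<lambda>t. f (z + t *\<^sub>R v)) has_real_derivative f' v) (at 0)"
    unfolding has_field_derivative_def
    by (rule has_derivative_eq_rhs)
      (simp add: fun_eq_iff linear_cmul[OF has_derivative_linear[OF f]])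
qed

text \<open>A Randers metric whose one-form \<open>C \<omega>\<close> has covariant derivative
  \<open>C (\<omega> \<otimes> \<omega> - h / \<beta>)\<close>, symmetric in its two arguments, so that the one-form is closed.\<close>

locale randers_domain = riemannian_domain S h
  for S :: "'e::euclidean_space set" and h :: "'e \<Rightarrow> 'e \<Rightarrow> 'e \<Rightarrow> real" +
  fixes \<omega> :: "'e \<Rightarrow> 'e \<Rightarrow> real" and \<beta> C :: real and F :: "'e \<Rightarrow> 'e \<Rightarrow> real"
  assumes \<beta>: "\<beta> \<noteq> 0"
    and linear_\<omega>: "x \<in> S \<Longrightarrow> linear (\<omega> x)"
    and \<omega>_derivative: "x \<in> S \<Longrightarrow> ((\<lambda>x. \<omega> x w) has_derivative
          (\<lambda>u. \<omega> x u * \<omega> x w - h x u w / \<beta> + \<omega> x (levi_civita h x u w))) (at x)"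
    and \<omega>_bound: "x \<in> S \<Longrightarrow> y \<noteq> 0 \<Longrightarrow> \<bar>C * \<omega> x y\<bar> < sqrt (h x y y)"
    and F_eq: "x \<in> S \<Longrightarrow> F x y = sqrt (h x y y) + C * \<omega> x y"
begin

text \<open>With subscripts for derivatives in \<open>y\<close>: \<open>r = \<nabla>\<omega>\<close>, \<open>l = F\<^sub>y\<close>, \<open>A = \<alpha>\<^sub>y\<^sub>y\<close>, \<open>A3 = \<alpha>\<^sub>y\<^sub>y\<^sub>y\<close>,
  \<open>gF = (F\<^sup>2)\<^sub>y\<^sub>y / 2\<close>, \<open>dP = P\<^sub>y\<close>, and \<open>N\<close> is the derivative in \<open>y\<close> of the spray.\<close>

definition \<alpha> :: "'e \<Rightarrow> 'e \<Rightarrow> real" where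
  "\<alpha> x y = sqrt (h x y y)"

definition r :: "'e \<Rightarrow> 'e \<Rightarrow> 'e \<Rightarrow> real" where
  "r x u w = \<omega> x u * \<omega> x w - h x u w / \<beta>"

definition l :: "'e \<Rightarrow> 'e \<Rightarrow> 'e \<Rightarrow> real" where
  "l x y z = h x y z / \<alpha> x y + C * \<omega> x z"

definition A :: "'e \<Rightarrow> 'e \<Rightarrow> 'e \<Rightarrow> 'e \<Rightarrow> real" where
  "A x y w z = h x w z / \<alpha> x y - h x y w * h x y z / \<alpha> x y ^ 3"

definition A3 :: "'e \<Rightarrow> 'e \<Rightarrow> 'e \<Rightarrow> 'e \<Rightarrow> 'e \<Rightarrow> real" where
  "A3 x y k w z = 3 * h x y k * h x y w * h x y z / \<alpha> x y ^ 5
    - (h x w z * h x y k + h x k w * h x y z + h x k z * h x y w) / \<alpha> x y ^ 3"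

definition gF :: "'e \<Rightarrow> 'e \<Rightarrow> 'e \<Rightarrow> 'e \<Rightarrow> real" where
  "gF x y w z = l x y w * l x y z + F x y * A x y w z"

definition P :: "'e \<Rightarrow> 'e \<Rightarrow> real" where
  "P x y = C * r x y y / (2 * F x y)"

definition dP :: "'e \<Rightarrow> 'e \<Rightarrow> 'e \<Rightarrow> real" where
  "dP x y u = (C * r x u y - P x y * l x y u) / F x y"

definition N :: "'e \<Rightarrow> 'e \<Rightarrow> 'e \<Rightarrow> 'e" where
  "N x y u = \<Gamma> x y u + dP x y u *\<^sub>R y + P x y *\<^sub>R u"

text \<open>The derivatives below are taken jointly in \<open>(x, y)\<close> and written with the vertical part
  \<open>snd d + \<Gamma> x (fst d) y\<close> of the direction \<open>d\<close>.\<close>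

definition vert :: "'e \<Rightarrow> 'e \<Rightarrow> 'e \<times> 'e \<Rightarrow> 'e" where
  "vert x y d = snd d + \<Gamma> x (fst d) y"

lemmas \<omega>_add = linear_\<omega>[THEN linear_add]
lemmas \<omega>_scale = linear_\<omega>[THEN linear_cmul]

lemmas \<omega>_diff = linear_\<omega>[THEN linear_diff]

lemma r_sym: "x \<in> S \<Longrightarrow> r x u w = r x w u"
  by (simp add: r_def sym[of x u w])

lemma bilinear_r: "x \<in> S \<Longrightarrow> bilinear (r x)"
  by (auto simp: bilinear_def r_def h_add h_scale \<omega>_add \<omega>_scale add_divide_distrib algebra_simps intro!: linearI)

lemma linear_l: "x \<in> S \<Longrightarrow> linear (l x y)"
  by (auto simp: l_def h_add h_scale \<omega>_add \<omega>_scale add_divide_distrib algebra_simps intro!: linearI)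

lemma A_sym: "x \<in> S \<Longrightarrow> A x y u w = A x y w u"
  by (simp add: A_def sym[of x u w])

lemma bilinear_A: "x \<in> S \<Longrightarrow> bilinear (A x y)"
  by (auto simp: bilinear_def A_def h_add h_scale add_divide_distrib diff_divide_distrib algebra_simps intro!: linearI)

lemma linear_A3:
  assumes "x \<in> S"
  shows "linear (\<lambda>k. A3 x y k w z)" "linear (\<lambda>w. A3 x y k w z)" "linear (\<lambda>z. A3 x y k w z)"
  by (auto simp: A3_def h_add[OF assms] h_scale[OF assms] add_divide_distrib diff_divide_distrib
    algebra_simps intro!: linearI)

lemma bilinear_gF:
  assumes x: "x \<in> S" shows "bilinear (gF x y)"
  unfolding bilinear_def
  by (intro conjI allI linearI) (simp_all add: gF_def linear_add[OF linear_l[OF x]] linear_cmul[OF linear_l[OF x]]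
    bilinear_ladd[OF bilinear_A[OF x]] bilinear_radd[OF bilinear_A[OF x]]
    bilinear_lmul[OF bilinear_A[OF x]] bilinear_rmul[OF bilinear_A[OF x]] algebra_simps)

lemma gF_sym: "x \<in> S \<Longrightarrow> gF x y u w = gF x y w u"
  by (simp add: gF_def A_sym[of x y u w])

lemma linear_dP:
  assumes x: "x \<in> S" shows "linear (dP x y)"
  unfolding dP_def
  by (intro linearI) (simp_all add: linear_add[OF linear_l[OF x]] linear_cmul[OF linear_l[OF x]]
    bilinear_ladd[OF bilinear_r[OF x]] bilinear_lmul[OF bilinear_r[OF x]]
    add_divide_distrib diff_divide_distrib algebra_simps)

lemma bilinear_r': "x \<in> S \<Longrightarrow> r x (u + v) w = r x u w + r x v w" "x \<in> S \<Longrightarrow> r x w (u + v) = r x w u + r x w v"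
  "x \<in> S \<Longrightarrow> r x (c *\<^sub>R u) w = c * r x u w" "x \<in> S \<Longrightarrow> r x w (c *\<^sub>R u) = c * r x w u"
  "x \<in> S \<Longrightarrow> r x (- u) w = - r x u w" "x \<in> S \<Longrightarrow> r x w (- u) = - r x w u"
  by (simp_all add: bilinear_ladd[OF bilinear_r] bilinear_radd[OF bilinear_r] bilinear_lmul[OF bilinear_r]
    bilinear_rmul[OF bilinear_r] bilinear_lneg[OF bilinear_r] bilinear_rneg[OF bilinear_r])

lemmas l_add = linear_l[THEN linear_add]
lemmas l_scale = linear_l[THEN linear_cmul]
lemmas l_neg = linear_l[THEN linear_neg]
lemmas A_add = bilinear_A[THEN bilinear_ladd] bilinear_A[THEN bilinear_radd]
lemmas A_scale = bilinear_A[THEN bilinear_lmul] bilinear_A[THEN bilinear_rmul]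
lemmas A_neg = bilinear_A[THEN bilinear_lneg] bilinear_A[THEN bilinear_rneg]
lemmas gF_add = bilinear_gF[THEN bilinear_ladd] bilinear_gF[THEN bilinear_radd]
lemmas gF_scale = bilinear_gF[THEN bilinear_lmul] bilinear_gF[THEN bilinear_rmul]
lemmas A3_add = linear_A3[THEN linear_add]
lemmas A3_scale = linear_A3[THEN linear_cmul]
lemmas A3_neg = linear_A3[THEN linear_neg]
lemmas dP_add = linear_dP[THEN linear_add]
lemmas dP_scale = linear_dP[THEN linear_cmul]
lemmas dP_neg = linear_dP[THEN linear_neg]

section \<open>Homogeneity in \<open>y\<close> and positive definiteness of the fundamental
  tensor\<close>

definition U :: "('e \<times> 'e) set" where
  "U = S \<times> (UNIV - {0})"

lemma open_U: "open U"
  unfolding U_def by (intro open_Times open_S open_Diff) auto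

lemma in_U [simp]: "(x, y) \<in> U \<longleftrightarrow> x \<in> S \<and> y \<noteq> 0"
  by (simp add: U_def)

lemma in_U': "p \<in> U \<Longrightarrow> fst p \<in> S" "p \<in> U \<Longrightarrow> snd p \<noteq> 0"
  by (auto simp: U_def)

lemma h_pos: "x \<in> S \<Longrightarrow> y \<noteq> 0 \<Longrightarrow> h x y y > 0"
  using pos_definite by (simp add: pos_definite_def)

lemma \<alpha>_pos: "x \<in> S \<Longrightarrow> y \<noteq> 0 \<Longrightarrow> \<alpha> x y > 0"
  using h_pos by (simp add: \<alpha>_def)

lemma \<alpha>_sq: "x \<in> S \<Longrightarrow> y \<noteq> 0 \<Longrightarrow> h x y y = \<alpha> x y ^ 2"
  using h_pos[of x y] by (simp add: \<alpha>_def)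

lemma F_\<alpha>: "x \<in> S \<Longrightarrow> F x y = \<alpha> x y + C * \<omega> x y"
  by (simp add: F_eq \<alpha>_def)

lemma F_pos: "x \<in> S \<Longrightarrow> y \<noteq> 0 \<Longrightarrow> F x y > 0"
  using \<omega>_bound[of x y] F_eq[of x y] by linarith

text \<open>Euler's relations: in \<open>y\<close> the degrees are 1 for \<open>F\<close> and
  \<open>P\<close>, 0 for \<open>l\<close> and -1 for \<open>A\<close>. They account for this lemma
  and for \<open>A_self\<close>, \<open>A3_self\<close> and \<open>dP_self\<close>.\<close>

lemma l_self: "x \<in> S \<Longrightarrow> y \<noteq> 0 \<Longrightarrow> l x y y = F x y"
  using \<alpha>_pos[of x y] by (simp add: l_def F_\<alpha> \<alpha>_sq power2_eq_square)

lemma A_self: "x \<in> S \<Longrightarrow> y \<noteq> 0 \<Longrightarrow> A x y y z = 0" "x \<in> S \<Longrightarrow> y \<noteq> 0 \<Longrightarrow> A x y z y = 0"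
  using \<alpha>_pos[of x y] sym[of x z y] by (simp_all add: A_def \<alpha>_sq field_simps power2_eq_square power3_eq_cube)

lemma A3_self:
  assumes x: "x \<in> S" and y: "y \<noteq> 0"
  shows "A3 x y y w z = - A x y w z" "A3 x y k y z = - A x y k z" "A3 x y k w y = - A x y k w"
  using \<alpha>_pos[OF x y] sym[OF x, of k y] sym[OF x, of w y]
  by (simp_all add: A3_def A_def \<alpha>_sq[OF x y] sym[OF x, of z y] sym[OF x, of w k] field_simps eval_nat_numeral)

text \<open>Together with \<open>dP_F\<close>, which is the derivative of this relation in
  \<open>y\<close>, it serves to clear the denominators \<open>F\<close>; later computations are
  then polynomial identities modulo these two.\<close>

lemma P_F: "x \<in> S \<Longrightarrow> y \<noteq> 0 \<Longrightarrow> C * r x y y = 2 * P x y * F x y"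
  using F_pos[of x y] by (simp add: P_def)

lemma dP_F: "x \<in> S \<Longrightarrow> y \<noteq> 0 \<Longrightarrow> dP x y u * F x y = C * r x u y - P x y * l x y u"
  using F_pos[of x y] by (simp add: dP_def)

lemma dP_self: "x \<in> S \<Longrightarrow> y \<noteq> 0 \<Longrightarrow> dP x y y = P x y"
  using F_pos[of x y] by (simp add: dP_def P_F l_self)

lemma N_self: "x \<in> S \<Longrightarrow> y \<noteq> 0 \<Longrightarrow> N x y y = \<Gamma> x y y + (2 * P x y) *\<^sub>R y"
  by (simp add: N_def dP_self algebra_simps flip: scaleR_add_left)

lemma gF_self: "x \<in> S \<Longrightarrow> y \<noteq> 0 \<Longrightarrow> gF x y y z = F x y * l x y z"
  by (simp add: gF_def l_self A_self)

lemma A_gram: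
  assumes x: "x \<in> S" and y: "y \<noteq> 0"
  shows "A x y u u = (h x y y * h x u u - (h x y u)\<^sup>2) / \<alpha> x y ^ 3"
  using \<alpha>_pos[OF x y] by (simp add: A_def \<alpha>_sq[OF x y] field_simps eval_nat_numeral)

text \<open>\<open>gF x y u u\<close> is a square plus \<open>F\<close> times a Gram determinant
  over a positive factor. If the second term vanishes, \<open>u\<close> is parallel to
  \<open>y\<close>, and on such vectors \<open>l\<close> is nonzero because
  \<open>F > 0\<close>.\<close>

lemma pos_definite_gF:
  assumes x: "x \<in> S" and y: "y \<noteq> 0"
  shows "pos_definite (gF x y)"
  unfolding pos_definite_def
proof (intro conjI allI impI bilinear_gF[OF x])
  fix u :: 'e assume u: "u \<noteq> 0"
  have gram: "0 \<le> h x y y * h x u u - (h x y u)\<^sup>2"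
    using gram_det_nonneg[OF pos_definite[OF x] sym[OF x], of y u] sym[OF x, of y u] by simp
  then have A: "0 \<le> A x y u u"
    using \<alpha>_pos[OF x y] by (simp add: A_gram[OF x y])
  show "0 < gF x y u u"
  proof (cases "A x y u u = 0")
    case False
    then have "0 < F x y * A x y u u" using A F_pos[OF x y] by simp
    then show ?thesis unfolding gF_def by (simp add: add_nonneg_pos)
  next
    case True
    then have "h x y y * h x u u - (h x u y)\<^sup>2 = 0"
      using \<alpha>_pos[OF x y] sym[OF x, of y u] by (simp add: A_gram[OF x y])
    from gram_det_eq_0[OF pos_definite[OF x] sym[OF x] this]
    have *: "h x y y *\<^sub>R u = h x u y *\<^sub>R y" .
    then have "h x u y \<noteq> 0" using h_pos[OF x y] u by auto
    then have "l x y (h x y y *\<^sub>R u) \<noteq> 0"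
      unfolding * using F_pos[OF x y] by (simp add: l_scale[OF x] l_self[OF x y])
    then have "l x y u \<noteq> 0" by (simp add: l_scale[OF x])
    then show ?thesis using True by (simp add: gF_def flip: power2_eq_square)
  qed
qed

lemma \<omega>_covariant_derivative:
  assumes p: "(p :: 'p::real_normed_vector \<Rightarrow> 'e) q \<in> S" and dp: "(p has_derivative p') (at q)"
    and a: "(a has_derivative a') (at q)"
  shows "((\<lambda>s. \<omega> (p s) (a s)) has_derivative
    (\<lambda>d. r (p q) (p' d) (a q) + \<omega> (p q) (a' d + \<Gamma> (p q) (p' d) (a q)))) (at q)"
proof -
  obtain V where V: "open V" "q \<in> V" "\<And>r. r \<in> V \<Longrightarrow> p r \<in> S"
    using continuous_at_open[THEN iffD1, OF has_derivative_continuous[OF dp]] open_S p by metis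
  have "((\<lambda>r. \<omega> (p r) v) has_derivative
      (\<lambda>d. r (p q) (p' d) v + \<omega> (p q) (\<Gamma> (p q) (p' d) v))) (at q)" for v
    using has_derivative_compose[OF dp \<omega>_derivative[OF p]] by (simp add: r_def)
  from linear_family_has_derivative[where L = "\<lambda>r. \<omega> (p r)", OF V(1,2) linear_\<omega>[OF V(3)] this a]
  show ?thesis
    by (rule has_derivative_eq_rhs) (simp_all add: \<omega>_add[OF p] algebra_simps)
qed

lemma \<Gamma>_joint_derivative:
  assumes p: "(p :: 'p::real_normed_vector \<Rightarrow> 'e) q \<in> S" and dp: "(p has_derivative p') (at q)"
    and a: "(a has_derivative a') (at q)" and b: "(b has_derivative b') (at q)"
  shows "((\<lambda>s. \<Gamma> (p s) (a s) (b s)) has_derivative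
    (\<lambda>d. d\<Gamma> (p q) (a q) (b q) (p' d) + \<Gamma> (p q) (a' d) (b q) + \<Gamma> (p q) (a q) (b' d))) (at q)"
proof -
  obtain V where V: "open V" "q \<in> V" "\<And>r. r \<in> V \<Longrightarrow> p r \<in> S"
    using continuous_at_open[THEN iffD1, OF has_derivative_continuous[OF dp]] open_S p by metis
  have "((\<lambda>r. \<Gamma> (p r) v w) has_derivative (\<lambda>d. d\<Gamma> (p q) v w (p' d))) (at q)" for v w
    by (rule has_derivative_compose[OF dp \<Gamma>_derivative[OF p]])
  from bilinear_family_has_derivative[where B = "\<lambda>r. \<Gamma> (p r)", OF V(1,2) bilinear_\<Gamma>[OF V(3)] this a b]
  show ?thesis by simp
qed

section \<open>Joint derivatives in base point and direction\<close>

lemmas fst_snd_derivative = has_derivative_fst[OF has_derivative_ident] has_derivative_snd[OF has_derivative_ident]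

lemma \<alpha>_derivative:
  assumes x: "x \<in> S" and y: "y \<noteq> 0"
  shows "((\<lambda>p. \<alpha> (fst p) (snd p)) has_derivative (\<lambda>d. h x y (vert x y d) / \<alpha> x y)) (at (x, y))"
proof -
  have "((\<lambda>p. h (fst p) (snd p) (snd p)) has_derivative (\<lambda>d. 2 * h x y (vert x y d))) (at (x, y))"
    by (rule has_derivative_eq_rhs, rule h_covariant_derivative[OF _ fst_snd_derivative fst_snd_derivative(2)])
      (auto simp: x vert_def sym[OF x, of _ y])
  from has_derivative_real_sqrt[OF _ this] show ?thesis
    using h_pos[OF x y] by (auto simp: \<alpha>_def field_simps elim!: has_derivative_eq_rhs)
qed

lemma \<omega>_y_derivative:
  assumes x: "x \<in> S"
  shows "((\<lambda>p. \<omega> (fst p) (snd p)) has_derivative (\<lambda>d. r x (fst d) y + \<omega> x (vert x y d))) (at (x, y))"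
  using \<omega>_covariant_derivative[where q = "(x, y)", OF _ fst_snd_derivative] x by (simp add: vert_def)

lemma \<omega>_const_derivative:
  assumes x: "x \<in> S"
  shows "((\<lambda>p. \<omega> (fst p) z) has_derivative (\<lambda>d. r x (fst d) z + \<omega> x (\<Gamma> x (fst d) z))) (at (x, y))"
  using \<omega>_covariant_derivative[where q = "(x, y)", OF _ fst_snd_derivative(1) has_derivative_const] x by simp

lemma h_y_derivative:
  assumes x: "x \<in> S"
  shows "((\<lambda>p. h (fst p) (snd p) z) has_derivative (\<lambda>d. h x (vert x y d) z + h x y (\<Gamma> x (fst d) z))) (at (x, y))"
  using h_covariant_derivative[where q = "(x, y)", OF _ fst_snd_derivative has_derivative_const] x
  by (simp add: vert_def)

lemma h_const_derivative:
  assumes x: "x \<in> S"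
  shows "((\<lambda>p. h (fst p) w z) has_derivative (\<lambda>d. h x (\<Gamma> x (fst d) w) z + h x w (\<Gamma> x (fst d) z))) (at (x, y))"
  using h_covariant_derivative[where q = "(x, y)", OF _ fst_snd_derivative(1) has_derivative_const has_derivative_const] x
  by simp

text \<open>Directions with \<open>vert = 0\<close> are the horizontal ones of the Levi-Civita
  connection. Along them \<alpha> is constant, so only the one-form contributes, through its
  covariant derivative \<open>C * r\<close>.\<close>

lemma F_derivative:
  assumes x: "x \<in> S" and y: "y \<noteq> 0"
  shows "((\<lambda>p. F (fst p) (snd p)) has_derivative (\<lambda>d. l x y (vert x y d) + C * r x (fst d) y)) (at (x, y))"
proof (rule has_derivative_cong_open[OF _ open_U])
  show "((\<lambda>p. \<alpha> (fst p) (snd p) + C * \<omega> (fst p) (snd p)) has_derivative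
      (\<lambda>d. l x y (vert x y d) + C * r x (fst d) y)) (at (x, y))"
    by (rule has_derivative_eq_rhs, rule has_derivative_add[OF \<alpha>_derivative[OF x y]
      has_derivative_mult_right[OF \<omega>_y_derivative[OF x]]]) (simp add: l_def algebra_simps)
qed (use x y in \<open>auto simp: F_\<alpha> in_U'\<close>)

lemma l_derivative:
  assumes x: "x \<in> S" and y: "y \<noteq> 0"
  shows "((\<lambda>p. l (fst p) (snd p) z) has_derivative
    (\<lambda>d. A x y (vert x y d) z + C * r x (fst d) z + l x y (\<Gamma> x (fst d) z))) (at (x, y))"
  unfolding l_def
  by (rule has_derivative_eq_rhs, rule has_derivative_add[OF has_derivative_divide'[OF
      h_y_derivative[OF x] \<alpha>_derivative[OF x y]] has_derivative_mult_right[OF \<omega>_const_derivative[OF x]]])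
    (use \<alpha>_pos[OF x y] in \<open>simp_all add: fun_eq_iff A_def power3_eq_cube field_simps\<close>)

lemma A_derivative:
  assumes x: "x \<in> S" and y: "y \<noteq> 0"
  shows "((\<lambda>p. A (fst p) (snd p) w z) has_derivative
    (\<lambda>d. A3 x y (vert x y d) w z + A x y (\<Gamma> x (fst d) w) z + A x y w (\<Gamma> x (fst d) z))) (at (x, y))"
proof -
  note d = has_derivative_divide'[OF h_const_derivative[OF x, of w z] \<alpha>_derivative[OF x y]]
  note e = has_derivative_divide'[OF has_derivative_mult[OF h_y_derivative[OF x, of w] h_y_derivative[OF x, of z]]
    has_derivative_power[OF \<alpha>_derivative[OF x y], of 3]]
  show ?thesis
    unfolding A_def
    by (rule has_derivative_eq_rhs, rule has_derivative_diff[OF d e])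
      (use \<alpha>_pos[OF x y] in \<open>simp_all add: fun_eq_iff A3_def field_simps eval_nat_numeral\<close>)
qed

text \<open>Since \<open>h\<close> is parallel, only the part
  \<open>\<omega> \<otimes> \<omega>\<close> of \<open>r\<close> contributes horizontally, giving
  \<open>2 * \<omega> x y * r x (fst d) y\<close> for \<open>r x y y\<close>. The horizontal
  derivative of \<open>P\<close> is thus expressed by \<open>r\<close>, \<omega>, \<open>P\<close>
  and \<open>F\<close> again.\<close>

lemma P_derivative:
  assumes x: "x \<in> S" and y: "y \<noteq> 0"
  shows "((\<lambda>p. P (fst p) (snd p)) has_derivative
    (\<lambda>d. dP x y (vert x y d) + C * r x (fst d) y * (\<omega> x y - P x y) / F x y)) (at (x, y))"
proof -
  have "((\<lambda>p. h (fst p) (snd p) (snd p)) has_derivative (\<lambda>d. 2 * h x y (vert x y d))) (at (x, y))"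
    by (rule has_derivative_eq_rhs, rule h_covariant_derivative[OF _ fst_snd_derivative fst_snd_derivative(2)])
      (auto simp: x vert_def sym[OF x, of _ y])
  note h = has_derivative_mult_right[OF this, of "1 / \<beta>"]
  have "((\<lambda>p. r (fst p) (snd p) (snd p)) has_derivative
      (\<lambda>d. 2 * r x y (vert x y d) + 2 * \<omega> x y * r x (fst d) y)) (at (x, y))"
    unfolding r_def
    by (rule has_derivative_eq_rhs, rule has_derivative_cong_open[OF has_derivative_diff[OF
        has_derivative_mult[OF \<omega>_y_derivative[OF x] \<omega>_y_derivative[OF x]] h] open_U])
      (use x y in \<open>auto simp: r_def algebra_simps\<close>)
  from has_derivative_divide'[OF has_derivative_mult_right[OF this, of C]
      has_derivative_mult_right[OF F_derivative[OF x y], of 2]]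
  have "((\<lambda>p. P (fst p) (snd p)) has_derivative
    (\<lambda>d. (C * (2 * r x y (vert x y d) + 2 * \<omega> x y * r x (fst d) y) * (2 * F x y)
      - C * r x y y * (2 * (l x y (vert x y d) + C * r x (fst d) y))) / (2 * F x y * (2 * F x y)))) (at (x, y))"
    using F_pos[OF x y] by (simp add: P_def)
  moreover have "(C * (2 * R + 2 * \<omega> x y * s) * (2 * F x y) - C * r x y y * (2 * (L + C * s))) / (2 * F x y * (2 * F x y))
    = (C * R - P x y * L) / F x y + C * s * (\<omega> x y - P x y) / F x y" for R L s
    using F_pos[OF x y] unfolding P_F[OF x y] by (simp add: field_simps)
  ultimately show ?thesis unfolding dP_def r_sym[OF x, of "vert x y _"] by simp
qed

lemma r_derivative:
  assumes x: "x \<in> S"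
  shows "((\<lambda>p. r (fst p) w (snd p)) has_derivative
    (\<lambda>d. r x w (vert x y d) + r x (\<Gamma> x (fst d) w) y + r x (fst d) w * \<omega> x y + \<omega> x w * r x (fst d) y)) (at (x, y))"
proof -
  have h: "((\<lambda>p. h (fst p) w (snd p)) has_derivative (\<lambda>d. h x (\<Gamma> x (fst d) w) y + h x w (vert x y d))) (at (x, y))"
    using h_covariant_derivative[where q = "(x, y)", OF _ fst_snd_derivative(1) has_derivative_const fst_snd_derivative(2)] x
    by (simp add: vert_def)
  show ?thesis
    unfolding r_def
    by (rule has_derivative_eq_rhs, rule has_derivative_diff[OF has_derivative_mult[OF
        \<omega>_const_derivative[OF x] \<omega>_y_derivative[OF x]] has_derivative_divide'[OF h has_derivative_const]])
      (use \<beta> in \<open>simp_all add: fun_eq_iff r_def field_simps\<close>)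
qed

lemma dP_derivative:
  assumes x: "x \<in> S" and y: "y \<noteq> 0"
  shows "((\<lambda>p. dP (fst p) (snd p) w) has_derivative
    (\<lambda>d. dP x y (\<Gamma> x (fst d) w) + (C * (r x w (vert x y d) + r x (fst d) w * \<omega> x y + \<omega> x w * r x (fst d) y)
      - (dP x y (vert x y d) + C * r x (fst d) y * (\<omega> x y - P x y) / F x y) * l x y w
      - P x y * (A x y (vert x y d) w + C * r x (fst d) w)
      - dP x y w * (l x y (vert x y d) + C * r x (fst d) y)) / F x y)) (at (x, y))"
proof -
  note d = has_derivative_divide'[OF has_derivative_diff[OF has_derivative_mult_right[OF r_derivative[OF x, of w], of C]
    has_derivative_mult[OF P_derivative[OF x y] l_derivative[OF x y, of w]]] F_derivative[OF x y]]
  \<comment> \<open>Regroups the quotient rule: the two terms containing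
    \<open>\<Gamma> x (fst d) w\<close> form \<open>dP\<close> of that vector, and the rest is the
    covariant derivative of \<open>dP\<close>.\<close>
  have eq: "((C * (a + b + c + e) - (P x y * (k + m + lG) + P' * l x y w)) * F x y
      - (C * r x w y - P x y * l x y w) * F') / (F x y * F x y)
    = (C * b - P x y * lG) / F x y + (C * (a + c + e) - P' * l x y w - P x y * (k + m) - dP x y w * F') / F x y"
    for a b c e k m lG P' F'
    using F_pos[OF x y] unfolding dP_F[OF x y, symmetric] by (simp add: field_simps)
  show ?thesis
    by (rule has_derivative_eq_rhs, rule d[folded dP_def])
      (use F_pos[OF x y] in \<open>simp_all add: fun_eq_iff eq dP_def[of _ _ "\<Gamma> _ _ _"]\<close>)
qed

lemma vert_simps: "vert x y (0, a) = a" if "x \<in> S"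
  using that by (simp add: vert_def bilinear_lzero[OF bilinear_\<Gamma>])

lemma zero_simps:
  assumes "x \<in> S"
  shows "\<Gamma> x 0 z = 0" "r x 0 z = 0" "l x y 0 = 0" "h x 0 z = 0" "h x z 0 = 0" "A x y 0 z = 0" "\<omega> x 0 = 0"
  using assms by (simp_all add: bilinear_lzero[OF bilinear_\<Gamma>] bilinear_lzero[OF bilinear_r]
    linear_0[OF linear_l] linear_0[OF linear_\<omega>] bilinear_lzero[OF bilinear_h] bilinear_rzero[OF bilinear_h]
    bilinear_lzero[OF bilinear_A])

section \<open>Fundamental tensor, spray and nonlinear connection\<close>

lemma F_sq_derivative:
  assumes x: "x \<in> S" and y: "y \<noteq> 0"
  shows "((\<lambda>p. (F (fst p) (snd p))\<^sup>2) has_derivative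
    (\<lambda>d. 2 * F x y * (l x y (vert x y d) + C * r x (fst d) y))) (at (x, y))"
  using has_derivative_power[OF F_derivative[OF x y], of 2]
  by (simp add: mult.assoc mult.commute[of _ "F x y"])

lemma F_l_derivative:
  assumes x: "x \<in> S" and y: "y \<noteq> 0"
  shows "((\<lambda>p. 2 * F (fst p) (snd p) * l (fst p) (snd p) z) has_derivative
    (\<lambda>d. 2 * (gF x y (vert x y d) z + C * r x (fst d) y * l x y z
      + F x y * (C * r x (fst d) z + l x y (\<Gamma> x (fst d) z))))) (at (x, y))"
  by (rule has_derivative_eq_rhs, rule has_derivative_mult[OF has_derivative_mult_right[OF
      F_derivative[OF x y]] l_derivative[OF x y]])
    (simp add: fun_eq_iff gF_def algebra_simps)

lemma frechet_F_sq_y: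
  assumes x: "x \<in> S" and y: "y \<noteq> 0"
  shows "frechet_derivative (\<lambda>y. (F x y)\<^sup>2) (at y) z = 2 * F x y * l x y z"
  using frechet_derivative_eqI[OF has_derivative_partial(2)[where f = "\<lambda>x y. (F x y)\<^sup>2", OF F_sq_derivative[OF x y]]]
  by (simp add: vert_simps[OF x] zero_simps[OF x])

lemma fundamental_tensor_eq:
  assumes x: "x \<in> S" and y: "y \<noteq> 0"
  shows "fundamental_tensor F x y u v = gF x y u v"
proof -
  have inner: "deriv (\<lambda>t. (F x (z + t *\<^sub>R v))\<^sup>2) 0 = 2 * F x z * l x z v" if "z \<noteq> 0" for z
    using deriv_along_line[OF has_derivative_partial(2)[where f = "\<lambda>x y. (F x y)\<^sup>2", OF F_sq_derivative[OF x that]], of v]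
    by (simp add: vert_simps[OF x] zero_simps[OF x])
  \<comment> \<open>The outer derivative at 0 needs the inner formula for all \<open>s\<close> near
    0, where \<open>y + s *\<^sub>R u\<close> must stay off the zero section.\<close>
  have "eventually (\<lambda>s. y + s *\<^sub>R u \<noteq> 0) (nhds (0::real))"
  proof (rule eventually_nhds_in_open[of "{s. y + s *\<^sub>R u \<noteq> 0}", simplified])
    show "open {s. y + s *\<^sub>R u \<noteq> 0}" by (intro open_Collect_neq continuous_intros)
  qed (use y in simp)
  then have "eventually (\<lambda>s. deriv (\<lambda>t. (F x (y + s *\<^sub>R u + t *\<^sub>R v))\<^sup>2) 0
      = 2 * F x (y + s *\<^sub>R u) * l x (y + s *\<^sub>R u) v) (nhds 0)"
    by eventually_elim (rule inner)
  then have "fundamental_tensor F x y u v = (1/2) * deriv (\<lambda>s. 2 * F x (y + s *\<^sub>R u) * l x (y + s *\<^sub>R u) v) 0"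
    unfolding fundamental_tensor_def by (simp add: deriv_cong_ev)
  also have "\<dots> = gF x y u v"
    using deriv_along_line[OF has_derivative_partial(2)[where f = "\<lambda>x y. 2 * F x y * l x y v", OF F_l_derivative[OF x y]], of u]
    by (simp add: vert_simps[OF x] zero_simps[OF x])
  finally show ?thesis .
qed

lemma fundamental_tensor_eq': "x \<in> S \<Longrightarrow> y \<noteq> 0 \<Longrightarrow> fundamental_tensor F x y = gF x y"
  by (intro ext fundamental_tensor_eq)

text \<open>The one-form is closed, that is, \<open>r\<close> is symmetric, so the two terms
  \<open>F * C * r x y z\<close> cancel. What remains beside the spray of \<open>h\<close> is half
  of \<open>C * r x y y * l x y z\<close>, which equals \<open>P x y * gF x y y z\<close> by
  \<open>P_F\<close> and \<open>gF_self\<close>.\<close>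

lemma spray_eq:
  assumes x: "x \<in> S" and y: "y \<noteq> 0"
  shows "spray F x y = (1/2) *\<^sub>R \<Gamma> x y y + P x y *\<^sub>R y"
  unfolding spray_def fundamental_tensor_eq'[OF x y]
proof (rule raise_eqI[OF pos_definite_gF[OF x y]])
  fix z
  have "((\<lambda>x. frechet_derivative (\<lambda>y. (F x y)\<^sup>2) (at y) z) has_derivative
      (\<lambda>d. 2 * (gF x y (\<Gamma> x d y) z + C * r x d y * l x y z + F x y * (C * r x d z + l x y (\<Gamma> x d z))))) (at x)"
    by (rule has_derivative_cong_open[OF _ open_S x])
      (use has_derivative_partial(1)[where f = "\<lambda>x y. 2 * F x y * l x y z", OF F_l_derivative[OF x y]]
        in \<open>auto simp: vert_def frechet_F_sq_y y\<close>)
  then have 1: "frechet_derivative (\<lambda>x. frechet_derivative (\<lambda>y. (F x y)\<^sup>2) (at y) z) (at x) y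
      = 2 * (gF x y (\<Gamma> x y y) z + C * r x y y * l x y z + F x y * (C * r x y z + l x y (\<Gamma> x y z)))"
    by (simp add: frechet_derivative_eqI)
  have 2: "frechet_derivative (\<lambda>x. (F x y)\<^sup>2) (at x) z = 2 * F x y * (l x y (\<Gamma> x z y) + C * r x z y)"
    using frechet_derivative_eqI[OF has_derivative_partial(1)[where f = "\<lambda>x y. (F x y)\<^sup>2", OF F_sq_derivative[OF x y]]]
    by (simp add: vert_def)
  show "gF x y ((1/2) *\<^sub>R \<Gamma> x y y + P x y *\<^sub>R y) z = (1/4) *
      (frechet_derivative (\<lambda>x. frechet_derivative (\<lambda>y. (F x y)\<^sup>2) (at y) z) (at x) y
      - frechet_derivative (\<lambda>x. (F x y)\<^sup>2) (at x) z)"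
    unfolding 1 2 P_F[OF x y] r_sym[OF x, of z y] \<Gamma>_sym[OF x, of z y]
    by (simp add: gF_add[OF x] gF_scale[OF x] gF_self[OF x y] algebra_simps)
qed

lemma nonlinear_connection_eq:
  assumes x: "x \<in> S" and y: "y \<noteq> 0"
  shows "nonlinear_connection F x y u = N x y u"
proof -
  have "((\<lambda>y. (1/2) *\<^sub>R \<Gamma> x y y) has_derivative (\<lambda>d. \<Gamma> x y d)) (at y)"
    by (rule has_derivative_eq_rhs, rule has_derivative_scaleR_right,
        rule \<Gamma>_joint_derivative[where p = "\<lambda>_. x", OF x has_derivative_const has_derivative_ident has_derivative_ident])
      (simp add: fun_eq_iff linear_0[OF linear_d\<Gamma>[OF x]] \<Gamma>_sym[OF x, of _ y] flip: scaleR_2)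
  moreover have "((\<lambda>y. P x y *\<^sub>R y) has_derivative (\<lambda>d. P x y *\<^sub>R d + dP x y d *\<^sub>R y)) (at y)"
    using has_derivative_scaleR[OF has_derivative_partial(2)[OF P_derivative[OF x y]] has_derivative_ident]
    by (simp add: vert_simps[OF x] zero_simps[OF x])
  ultimately have "((\<lambda>y. (1/2) *\<^sub>R \<Gamma> x y y + P x y *\<^sub>R y) has_derivative (\<lambda>d. \<Gamma> x y d + (P x y *\<^sub>R d + dP x y d *\<^sub>R y))) (at y)"
    by (rule has_derivative_add)
  then have "((spray F x) has_derivative N x y) (at y)"
    by (rule has_derivative_eq_rhs[OF has_derivative_cong_open[where S = "UNIV - {0}"]])
      (use y in \<open>auto simp: spray_eq[OF x] N_def fun_eq_iff intro: open_Diff\<close>)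
  then show ?thesis by (simp add: nonlinear_connection_def frechet_derivative_eqI)
qed

section \<open>The Chern connection and its curvature\<close>

lemma gF_derivative:
  assumes x: "x \<in> S" and y: "y \<noteq> 0"
  shows "((\<lambda>p. gF (fst p) (snd p) w z) has_derivative (\<lambda>d.
    gF x y (\<Gamma> x (fst d) w) z + gF x y w (\<Gamma> x (fst d) z)
    + (A x y (vert x y d) w + C * r x (fst d) w) * l x y z
    + l x y w * (A x y (vert x y d) z + C * r x (fst d) z)
    + (l x y (vert x y d) + C * r x (fst d) y) * A x y w z
    + F x y * A3 x y (vert x y d) w z)) (at (x, y))"
  unfolding gF_def
  by (rule has_derivative_eq_rhs, rule has_derivative_add[OF
      has_derivative_mult[OF l_derivative[OF x y] l_derivative[OF x y]]
      has_derivative_mult[OF F_derivative[OF x y] A_derivative[OF x y]]])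
    (simp add: fun_eq_iff algebra_simps)

text \<open>Horizontal derivative of the fundamental tensor in closed form. The terms with
  \<open>C\<close> come from \<open>\<nabla>\<omega>\<close>, those with \<open>P\<close> from the
  vertical shift \<open>- P u\<close> against the Levi-Civita lift. The other part of the shift,
  \<open>- dP u\<close> times \<open>y\<close>, leaves no trace because \<open>gF\<close> has degree
  0 in \<open>y\<close>.\<close>

definition \<delta>g :: "'e \<Rightarrow> 'e \<Rightarrow> 'e \<Rightarrow> 'e \<Rightarrow> 'e \<Rightarrow> real" where
  "\<delta>g x y u w z = gF x y (\<Gamma> x u w) z + gF x y w (\<Gamma> x u z)
    + C * (r x u w * l x y z + l x y w * r x u z + r x u y * A x y w z)
    - P x y * (A x y u w * l x y z + l x y w * A x y u z + l x y u * A x y w z + F x y * A3 x y u w z)"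

lemma vert_horizontal:
  assumes x: "x \<in> S" shows "vert x y (u, - N x y u) = - (dP x y u *\<^sub>R y + P x y *\<^sub>R u)"
  by (simp add: vert_def N_def \<Gamma>_sym[OF x, of u y])

lemma horizontal_fundamental_tensor:
  assumes x: "x \<in> S" and y: "y \<noteq> 0"
  shows "horizontal_deriv F u (\<lambda>x y. fundamental_tensor F x y w z) x y = \<delta>g x y u w z"
proof -
  have "((\<lambda>p. fundamental_tensor F (fst p) (snd p) w z) has_derivative (\<lambda>d.
    gF x y (\<Gamma> x (fst d) w) z + gF x y w (\<Gamma> x (fst d) z)
    + (A x y (vert x y d) w + C * r x (fst d) w) * l x y z
    + l x y w * (A x y (vert x y d) z + C * r x (fst d) z)
    + (l x y (vert x y d) + C * r x (fst d) y) * A x y w z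
    + F x y * A3 x y (vert x y d) w z)) (at (x, y))"
    by (rule has_derivative_cong_open[OF gF_derivative[OF x y] open_U])
      (use x y in \<open>auto simp: fundamental_tensor_eq in_U'\<close>)
  from horizontal_deriv_eq[where f = "\<lambda>x y. fundamental_tensor F x y w z", OF this]
  show ?thesis
    by (simp add: nonlinear_connection_eq[OF x y] vert_horizontal[OF x] \<delta>g_def
      A_neg[OF x] A_add[OF x] A_scale[OF x] A_self[OF x y] l_neg[OF x] l_add[OF x] l_scale[OF x] l_self[OF x y]
      A3_neg[OF x] A3_add[OF x] A3_scale[OF x] A3_self[OF x y] del: minus_add_distrib)
      (simp add: algebra_simps)
qed

lemma linear_\<delta>g:
  assumes x: "x \<in> S"
  shows "linear (\<lambda>u. \<delta>g x y u w z)" "linear (\<lambda>w. \<delta>g x y u w z)" "linear (\<lambda>z. \<delta>g x y u w z)"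
proof -
  note simps = \<delta>g_def gF_add[OF x] gF_scale[OF x] \<Gamma>_add[OF x] \<Gamma>_scale[OF x] bilinear_r'(1-4)[OF x]
    l_add[OF x] l_scale[OF x] A_add[OF x] A_scale[OF x] A3_add[OF x] A3_scale[OF x] algebra_simps
  show "linear (\<lambda>u. \<delta>g x y u w z)" by (rule linearI) (simp_all add: simps)
  show "linear (\<lambda>w. \<delta>g x y u w z)" by (rule linearI) (simp_all add: simps)
  show "linear (\<lambda>z. \<delta>g x y u w z)" by (rule linearI) (simp_all add: simps)
qed

lemmas \<delta>g_add = linear_\<delta>g[THEN linear_add]
lemmas \<delta>g_scale = linear_\<delta>g[THEN linear_cmul]

lemma linear_chern_form:
  assumes x: "x \<in> S"
  shows "linear (\<lambda>z. (1/2) * (\<delta>g x y u w z + \<delta>g x y w u z - \<delta>g x y z u w))"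
  by (rule linearI) (simp_all add: \<delta>g_add[OF x] \<delta>g_scale[OF x] algebra_simps)

lemma chern_coeff_eq:
  assumes x: "x \<in> S" and y: "y \<noteq> 0"
  shows "chern_coeff F x y u w = raise (gF x y) (\<lambda>z. (1/2) * (\<delta>g x y u w z + \<delta>g x y w u z - \<delta>g x y z u w))"
  by (simp add: chern_coeff_def fundamental_tensor_eq'[OF x y] horizontal_fundamental_tensor[OF x y])

text \<open>With \<open>y\<close> inserted, the Euler relations remove \<open>A3\<close> and all
  terms with factor \<open>P\<close>. By \<open>dP_F\<close> and \<open>P_F\<close> the remaining
  terms with \<open>C\<close> regroup into
  \<open>2 * dP x y u * gF x y y z + 2 * P x y * gF x y u z\<close>.\<close>

lemma chern_coeff_self:
  assumes x: "x \<in> S" and y: "y \<noteq> 0"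
  shows "chern_coeff F x y u y = N x y u"
  unfolding chern_coeff_eq[OF x y]
proof (rule raise_eqI[OF pos_definite_gF[OF x y]])
  fix z
  have 1: "C * r x y u = dP x y u * F x y + P x y * l x y u" by (simp add: dP_F[OF x y] r_sym[OF x, of y u])
  have 2: "C * r x u y = dP x y u * F x y + P x y * l x y u" by (simp add: dP_F[OF x y])
  have "\<delta>g x y u y z + \<delta>g x y y u z - \<delta>g x y z u y
    = 2 * gF x y (\<Gamma> x y u) z + C * r x u y * l x y z + C * r x y u * l x y z + C * r x y y * A x y u z"
    by (simp add: \<delta>g_def gF_self[OF x y] l_self[OF x y] A_self[OF x y] A3_self[OF x y]
      \<Gamma>_sym[OF x, of u y] \<Gamma>_sym[OF x, of z y] \<Gamma>_sym[OF x, of z u] r_sym[OF x, of z y] r_sym[OF x, of z u]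
      gF_sym[OF x, of y "\<Gamma> x y u" z] gF_sym[OF x, of y u "\<Gamma> x y z"]
      gF_sym[OF x, of y "\<Gamma> x u z" y] A_sym[OF x, of y z u] algebra_simps)
  also have "\<dots> = 2 * gF x y (N x y u) z"
    unfolding 1 2 P_F[OF x y]
    by (simp add: N_def gF_add[OF x] gF_scale[OF x] gF_self[OF x y]) (simp add: gF_def algebra_simps)
  finally show "gF x y (N x y u) z = (1/2) * (\<delta>g x y u y z + \<delta>g x y y u z - \<delta>g x y z u y)" by simp
qed

lemma linear_chern_coeff:
  assumes x: "x \<in> S" and y: "y \<noteq> 0"
  shows "linear (chern_coeff F x y u)"
proof -
  have "linear (\<lambda>w. raise (gF x y) (\<lambda>z. (1/2) * (\<delta>g x y u w z + \<delta>g x y w u z - \<delta>g x y z u w)))"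
    by (rule raise_linear[OF pos_definite_gF[OF x y] linear_chern_form[OF x]])
      (simp_all add: \<delta>g_add[OF x] \<delta>g_scale[OF x] algebra_simps)
  then show ?thesis by (simp add: chern_coeff_eq[OF x y, abs_def])
qed

lemma \<delta>g_differentiable:
  assumes x: "x \<in> S" and y: "y \<noteq> 0"
  shows "(\<lambda>p. \<delta>g (fst p) (snd p) u w z) differentiable (at (x, y))"
proof -
  have U: "(x, y) \<in> U" using x y by simp
  note d = differentiableI[OF l_derivative[OF x y]] differentiableI[OF A_derivative[OF x y]]
    differentiableI[OF gF_derivative[OF x y]] differentiableI[OF F_derivative[OF x y]]
    differentiableI[OF P_derivative[OF x y]]
    differentiableI[OF \<omega>_const_derivative[OF x]] differentiableI[OF h_const_derivative[OF x]]
    differentiableI[OF h_y_derivative[OF x]] differentiableI[OF \<alpha>_derivative[OF x y]]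
    differentiableI[OF r_derivative[OF x]]
  have \<Gamma>d: "(\<lambda>p. \<Gamma> (fst p) v w) differentiable (at (x, y))" for v w
    using differentiableI[OF \<Gamma>_joint_derivative[where q = "(x, y)", OF _ fst_snd_derivative(1)
      has_derivative_const has_derivative_const]] x by simp
  have const: "(\<lambda>_. v) differentiable (at (x, y))" for v :: 'e by simp
  have g: "(\<lambda>p. gF (fst p) (snd p) (\<Gamma> (fst p) u w) z) differentiable (at (x, y))"
    "(\<lambda>p. gF (fst p) (snd p) z (\<Gamma> (fst p) u w)) differentiable (at (x, y))" for u w z
    by (rule bilinear_family_differentiable[where B = "\<lambda>p. gF (fst p) (snd p)", OF open_U U bilinear_gF]; 
      (rule d \<Gamma>d const | simp add: in_U'))+
  have r: "(\<lambda>p. r (fst p) v w) differentiable (at (x, y))" for v w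
    unfolding r_def by ((rule d | rule differentiable_const | rule differentiable_diff differentiable_mult differentiable_divide)+) (rule \<beta>)
  have \<alpha>0: "\<alpha> x y \<noteq> 0" using \<alpha>_pos[OF x y] by simp
  have A3: "(\<lambda>p. A3 (fst p) (snd p) u w z) differentiable (at (x, y))"
    unfolding A3_def by ((rule d | rule differentiable_const | rule differentiable_add differentiable_diff
      differentiable_mult differentiable_divide differentiable_power | simp add: \<alpha>0)+)
  show ?thesis
    unfolding \<delta>g_def
    by ((rule g r A3 d | rule differentiable_const | rule differentiable_add differentiable_diff differentiable_mult)+)
qed

lemma chern_coeff_differentiable:
  assumes x: "x \<in> S" and y: "y \<noteq> 0"
  shows "(\<lambda>p. chern_coeff F (fst p) (snd p) u w) differentiable (at (x, y))"
proof (rule differentiable_cong_open[OF _ open_U])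
  show "(\<lambda>p. raise (gF (fst p) (snd p)) (\<lambda>z. (1/2) * (\<delta>g (fst p) (snd p) u w z
      + \<delta>g (fst p) (snd p) w u z - \<delta>g (fst p) (snd p) z u w))) differentiable (at (x, y))"
    by (rule raise_differentiable[OF open_U])
      (use x y in \<open>auto intro!: pos_definite_gF linear_chern_form[simplified] in_U' derivative_intros \<delta>g_differentiable
        differentiableI[OF gF_derivative[OF x y]]\<close>)
qed (use x y in \<open>auto simp: chern_coeff_eq in_U'\<close>)

text \<open>Since \<open>\<Gamma>\<^sup>i\<^sub>j\<^sub>k y\<^sup>k = N\<^sup>i\<^sub>j\<close>, the Chern curvature applied to \<open>y\<close> is the curvature of the nonlinear
  connection.\<close>

lemma chern_curvature_eq_nonlinear:
  assumes x: "x \<in> S" and y: "y \<noteq> 0"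
    and dN: "\<And>w. ((\<lambda>p. N (fst p) (snd p) w) has_derivative dN w) (at (x, y))"
  shows "chern_curvature F x y u w y = dN w (u, - N x y u) - dN u (w, - N x y w)"
proof -
  define D where "D w z = frechet_derivative (\<lambda>p. chern_coeff F (fst p) (snd p) w z) (at (x, y))" for w z
  have D: "((\<lambda>p. chern_coeff F (fst p) (snd p) w z) has_derivative D w z) (at (x, y))" for w z
    unfolding D_def using chern_coeff_differentiable[OF x y] by (simp add: frechet_derivative_works)
  have "dN w d = D w y d + chern_coeff F x y w (snd d)" for w d
  proof -
    have "((\<lambda>p. chern_coeff F (fst p) (snd p) w (snd p)) has_derivative
        (\<lambda>d. D w (snd (x, y)) d + chern_coeff F (fst (x, y)) (snd (x, y)) w (snd d))) (at (x, y))"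
      by (rule linear_family_has_derivative[where L = "\<lambda>p. chern_coeff F (fst p) (snd p) w"
          and L' = "\<lambda>d v. D w v d", OF open_U _ linear_chern_coeff])
        (use x y D fst_snd_derivative in \<open>auto simp: in_U'\<close>)
    then have "((\<lambda>p. N (fst p) (snd p) w) has_derivative (\<lambda>d. D w y d + chern_coeff F x y w (snd d))) (at (x, y))"
      by (rule has_derivative_cong_open[OF has_derivative_eq_rhs open_U])
        (use x y in \<open>auto simp: in_U' chern_coeff_self\<close>)
    from has_derivative_unique[OF dN this] show ?thesis by (rule fun_cong)
  qed
  then have D_eq: "D w y d = dN w d - chern_coeff F x y w (snd d)" for w d by simp
  have neg: "chern_coeff F x y u (- z) = - chern_coeff F x y u z" for u z
    by (rule linear_neg[OF linear_chern_coeff[OF x y]])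
  have const: "chern_deriv F w (\<lambda>x y. y0) = (\<lambda>x y. chern_coeff F x y w y0)" for w y0
    by (intro ext) (simp add: chern_deriv_def horizontal_deriv_def)
  have horiz: "horizontal_deriv F u (\<lambda>x y. chern_coeff F x y w z) x y = D w z (u, - N x y u)" for u w z
    using horizontal_deriv_eq[where f = "\<lambda>x y. chern_coeff F x y w z", OF D]
    by (simp add: nonlinear_connection_eq[OF x y])
  \<comment> \<open>Replacing \<open>D w y\<close> by \<open>dN w\<close> leaves
    \<open>chern_coeff\<close> of \<open>w\<close> on \<open>N x y u\<close> plus
    \<open>chern_coeff\<close> of \<open>u\<close> on \<open>N x y w\<close>; this is symmetric in
    \<open>u\<close> and \<open>w\<close> and cancels in the difference.\<close>
  show ?thesis
    unfolding chern_curvature_def const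
    unfolding chern_deriv_def horiz
    by (simp add: D_eq neg chern_coeff_self[OF x y])
qed

end

section \<open>Flag curvature\<close>

text \<open>Gives uniqueness in the \<open>THE\<close> of \<open>flag_curvature\<close>: without
  such a \<open>u\<close> its universally quantified condition would hold for every number.\<close>

lemma flag_second_vector:
  assumes "flag P (y :: 'e::euclidean_space)"
  obtains u where "P = span {u, y}"
proof -
  have P: "subspace P" "dim P = 2" "y \<in> P" "y \<noteq> 0" using assms by (auto simp: flag_def)
  have "\<not> P \<subseteq> span {y}"
  proof
    assume "P \<subseteq> span {y}"
    then have "dim P \<le> dim {y}" using dim_subset[of P "span {y}"] by simp
    also have "\<dots> \<le> 1" using dim_le_card'[of "{y}"] by simp
    finally show False using P(2) by simp
  qed
  then obtain u where u: "u \<in> P" "u \<notin> span {y}" by blast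
  then have ind: "independent {u, y}" using P(4) by (simp add: independent_insert)
  have "u \<noteq> y" using u(2) span_base by blast
  then have "P \<subseteq> span {u, y}"
    using card_ge_dim_independent[of "{u, y}" P] u(1) P(2,3) ind by simp
  moreover have "span {u, y} \<subseteq> P" using u(1) P by (intro span_minimal) auto
  ultimately show thesis using that by blast
qed

context randers_domain
begin

definition P' :: "'e \<Rightarrow> 'e \<Rightarrow> 'e \<times> 'e \<Rightarrow> real" where
  "P' x y d = dP x y (vert x y d) + C * r x (fst d) y * (\<omega> x y - P x y) / F x y"

definition ddP :: "'e \<Rightarrow> 'e \<Rightarrow> 'e \<Rightarrow> 'e \<times> 'e \<Rightarrow> real" where
  "ddP x y w d = dP x y (\<Gamma> x (fst d) w) + (C * (r x w (vert x y d) + r x (fst d) w * \<omega> x y + \<omega> x w * r x (fst d) y)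
      - P' x y d * l x y w - P x y * (A x y (vert x y d) w + C * r x (fst d) w)
      - dP x y w * (l x y (vert x y d) + C * r x (fst d) y)) / F x y"

lemma N_derivative:
  assumes x: "x \<in> S" and y: "y \<noteq> 0"
  shows "((\<lambda>p. N (fst p) (snd p) w) has_derivative
    (\<lambda>d. d\<Gamma> x y w (fst d) + \<Gamma> x (snd d) w + ddP x y w d *\<^sub>R y + dP x y w *\<^sub>R snd d + P' x y d *\<^sub>R w)) (at (x, y))"
proof -
  have "((\<lambda>p. \<Gamma> (fst p) (snd p) w) has_derivative (\<lambda>d. d\<Gamma> x y w (fst d) + \<Gamma> x (snd d) w)) (at (x, y))"
    using \<Gamma>_joint_derivative[where q = "(x, y)", OF _ fst_snd_derivative has_derivative_const] x
    by (simp add: bilinear_rzero[OF bilinear_\<Gamma>[OF x]])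
  from has_derivative_add[OF has_derivative_add[OF this has_derivative_scaleR[OF dP_derivative[OF x y, of w]
    fst_snd_derivative(2)]] has_derivative_scaleR[OF P_derivative[OF x y] has_derivative_const]]
  show ?thesis
    unfolding N_def by (rule has_derivative_eq_rhs) (simp add: fun_eq_iff ddP_def P'_def algebra_simps)
qed

text \<open>The Ricci identity for \<omega>. The covariant derivative of \<open>r\<close> along
  \<open>u\<close> is \<open>r x u w * \<omega> x z + \<omega> x w * r x u z\<close> on
  \<open>w\<close>, \<open>z\<close>; alternating in \<open>u\<close> and \<open>w\<close> kills the
  first term by symmetry of \<open>r\<close>.\<close>

lemma \<omega>_Rm:
  assumes x: "x \<in> S"
  shows "\<omega> x (Rm x u w z) = \<omega> x u * r x w z - \<omega> x w * r x u z"
proof -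
  have 1: "((\<lambda>x. \<omega> x z) has_derivative (\<lambda>a. r x a z + \<omega> x (\<Gamma> x a z))) (at x)" if "x \<in> S" for x
    using \<omega>_derivative[OF that, of z] by (simp add: r_def)
  have \<omega>1: "((\<lambda>x. \<omega> x v) has_derivative (\<lambda>w. r x w v + \<omega> x (\<Gamma> x w v))) (at x)" for v
    using 1[OF x] \<omega>_derivative[OF x, of v] by (simp add: r_def)
  have h1: "((\<lambda>x. h x a z) has_derivative (\<lambda>w. h x (\<Gamma> x w a) z + h x a (\<Gamma> x w z))) (at x)" for a
    using h_covariant_derivative[where p = "\<lambda>x. x", OF x has_derivative_ident has_derivative_const has_derivative_const]
    by simp
  have 2: "((\<lambda>x. r x a z + \<omega> x (\<Gamma> x a z)) has_derivative
      (\<lambda>w. (\<omega> x a * (r x w z + \<omega> x (\<Gamma> x w z)) + (r x w a + \<omega> x (\<Gamma> x w a)) * \<omega> x z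
          - (h x (\<Gamma> x w a) z + h x a (\<Gamma> x w z)) / \<beta>)
        + (r x w (\<Gamma> x a z) + \<omega> x (d\<Gamma> x a z w + \<Gamma> x w (\<Gamma> x a z))))) (at x)" for a
    unfolding r_def[of _ a z]
    by (intro has_derivative_add has_derivative_diff has_derivative_mult \<omega>1
        \<omega>_covariant_derivative[where p = "\<lambda>x. x", OF x has_derivative_ident \<Gamma>_derivative[OF x]]
        has_derivative_divide'[OF h1 has_derivative_const, THEN has_derivative_eq_rhs])
      (use \<beta> in \<open>simp_all add: fun_eq_iff field_simps\<close>)
  have "\<omega> x u * r x w z + (r x w (\<Gamma> x u z) - h x u (\<Gamma> x w z) / \<beta> + \<omega> x u * \<omega> x (\<Gamma> x w z)) + \<omega> x (d\<Gamma> x u z w + \<Gamma> x w (\<Gamma> x u z))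
    = \<omega> x w * r x u z + (r x u (\<Gamma> x w z) - h x w (\<Gamma> x u z) / \<beta> + \<omega> x w * \<omega> x (\<Gamma> x u z)) + \<omega> x (d\<Gamma> x w z u + \<Gamma> x u (\<Gamma> x w z))"
    using symmetric_second_derivative[OF open_S x 1 2 2, of w u]
    by (simp add: r_sym[OF x, of u w] \<Gamma>_sym[OF x, of u w] add_divide_distrib algebra_simps)
  then have "\<omega> x u * r x w z + \<omega> x (d\<Gamma> x u z w + \<Gamma> x w (\<Gamma> x u z))
    = \<omega> x w * r x u z + \<omega> x (d\<Gamma> x w z u + \<Gamma> x u (\<Gamma> x w z))"
    by (simp add: r_def[of x w "\<Gamma> x u z"] r_def[of x u "\<Gamma> x w z"])
  then show ?thesis by (simp add: Rm_eq[OF x] \<omega>_diff[OF x])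
qed

text \<open>This is \<open>P\<^sup>2\<close> minus the derivative of \<open>P\<close> along the
  geodesics of \<open>h\<close>. By \<open>P_derivative\<close> and \<open>P_F\<close> that
  derivative is \<open>2 * P x y * (\<omega> x y - P x y)\<close>.\<close>

definition \<Xi> :: "'e \<Rightarrow> 'e \<Rightarrow> real" where
  "\<Xi> x y = 3 * (P x y)\<^sup>2 - 2 * P x y * \<omega> x y"

lemma chern_curvature_eq:
  assumes x: "x \<in> S" and y: "y \<noteq> 0"
  shows "chern_curvature F x y u y y = Rm x u y y + \<Xi> x y *\<^sub>R u
    - ((C * (\<omega> x u * r x y y - \<omega> x y * r x u y) + \<Xi> x y * l x y u) / F x y) *\<^sub>R y"
proof -
  have F: "F x y \<noteq> 0" using F_pos[OF x y] by simp
  define p where "p = dP x y u"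
  define q where "q = P x y"
  define s where "s = 2 * q"
  define t1 where "t1 = ddP x y y (u, - N x y u)"
  define t2 where "t2 = ddP x y u (y, - N x y y)"
  define a1 where "a1 = P' x y (u, - N x y u)"
  define a2 where "a2 = P' x y (y, - N x y y)"
  have Nu: "N x y u = \<Gamma> x y u + p *\<^sub>R y + q *\<^sub>R u" by (simp add: N_def p_def q_def)
  have Ny: "N x y y = \<Gamma> x y y + s *\<^sub>R y" by (simp add: N_self[OF x y] q_def s_def)
  have vy: "vert x y (y, - N x y y) = (- 2 * P x y) *\<^sub>R y"
    by (simp add: vert_horizontal[OF x] dP_self[OF x y] flip: scaleR_add_left)
  \<comment> \<open>Here \<open>P\<close> is differentiated along the spray of \<open>F\<close>, not
    of \<open>h\<close>. The vertical shift \<open>- 2 * P x y\<close> times \<open>y\<close> adds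
    \<open>- 2 * q\<^sup>2\<close>, so \<open>- q\<^sup>2 - a2\<close> is still \<Xi>.\<close>
  have a2: "a2 = 2 * q * \<omega> x y - 4 * q\<^sup>2"
    unfolding a2_def P'_def vy fst_conv P_F[OF x y] q_def
    using F by (simp add: dP_neg[OF x] dP_scale[OF x] dP_self[OF x y] power2_eq_square field_simps)
  have "chern_curvature F x y u y y =
      (d\<Gamma> x y y u + \<Gamma> x (- N x y u) y + t1 *\<^sub>R y + q *\<^sub>R (- N x y u) + a1 *\<^sub>R y)
      - (d\<Gamma> x y u y + \<Gamma> x (- N x y y) u + t2 *\<^sub>R y + p *\<^sub>R (- N x y y) + a2 *\<^sub>R u)"
    unfolding chern_curvature_eq_nonlinear[OF x y N_derivative[OF x y]]
      t1_def t2_def a1_def a2_def p_def q_def fst_conv snd_conv dP_self[OF x y]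
    by (rule refl)
  \<comment> \<open>The terms mixing \<Gamma> with \<open>p\<close> or \<open>q\<close> cancel,
    since \<open>N x y y\<close> carries \<open>s = 2 * q\<close>.\<close>
  also have "\<dots> = Rm x u y y + (- q\<^sup>2 - a2) *\<^sub>R u + (t1 - t2 + a1 - q * p + p * s) *\<^sub>R y"
  proof -
    have 1: "\<Gamma> x (- N x y u) y = - \<Gamma> x y (\<Gamma> x u y) - p *\<^sub>R \<Gamma> x y y - q *\<^sub>R \<Gamma> x u y"
      by (simp add: Nu \<Gamma>_add[OF x] \<Gamma>_scale[OF x] \<Gamma>_neg[OF x] bilinear_lsub[OF bilinear_\<Gamma>[OF x]]
        \<Gamma>_sym[OF x, of "\<Gamma> x u y" y] \<Gamma>_sym[OF x, of y u])
    have 2: "\<Gamma> x (- N x y y) u = - \<Gamma> x u (\<Gamma> x y y) - s *\<^sub>R \<Gamma> x u y"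
      by (simp add: Ny \<Gamma>_add[OF x] \<Gamma>_scale[OF x] \<Gamma>_neg[OF x] bilinear_lsub[OF bilinear_\<Gamma>[OF x]]
        \<Gamma>_sym[OF x, of "\<Gamma> x y y" u] \<Gamma>_sym[OF x, of y u])
    have 3: "d\<Gamma> x y u y = d\<Gamma> x u y y" by (simp add: d\<Gamma>_sym[OF x, of y u])
    have 4: "s *\<^sub>R \<Gamma> x u y = q *\<^sub>R \<Gamma> x u y + q *\<^sub>R \<Gamma> x u y"
      by (simp add: s_def flip: scaleR_add_left)
    show ?thesis
      unfolding 1 2 3 4
      unfolding Nu Ny Rm_eq[OF x] \<Gamma>_sym[OF x, of y u]
      by (simp add: algebra_simps power2_eq_square)
  qed
  also have "- q\<^sup>2 - a2 = \<Xi> x y"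
    by (simp add: a2 \<Xi>_def q_def)
  also have "t1 - t2 + a1 - q * p + p * s = - ((C * (\<omega> x u * r x y y - \<omega> x y * r x u y) + \<Xi> x y * l x y u) / F x y)"
  proof -
    define \<rho> where "\<rho> = r x y y"
    define ru where "ru = r x u y"
    have \<rho>: "C * \<rho> = 2 * q * F x y" by (simp add: \<rho>_def q_def P_F[OF x y])
    have p: "p * F x y = C * ru - q * l x y u" by (simp add: p_def q_def ru_def dP_F[OF x y])
    have dP_v: "dP x y (vert x y (u, - N x y u)) = - (2 * q * p)"
      unfolding vert_horizontal[OF x]
      by (simp add: dP_neg[OF x] dP_add[OF x] dP_scale[OF x] dP_self[OF x y] p_def q_def del: minus_add_distrib)
    have l_v: "l x y (vert x y (u, - N x y u)) = - (p * F x y + q * l x y u)"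
      unfolding vert_horizontal[OF x]
      by (simp add: l_neg[OF x] l_add[OF x] l_scale[OF x] l_self[OF x y] p_def q_def del: minus_add_distrib)
    have r_v: "r x y (vert x y (u, - N x y u)) = - (p * \<rho> + q * ru)"
      unfolding vert_horizontal[OF x]
      by (simp add: bilinear_r'[OF x] r_sym[OF x, of y u] p_def q_def \<rho>_def ru_def del: minus_add_distrib)
    have a1: "a1 * F x y = C * ru * (\<omega> x y - q) - 2 * q * p * F x y"
      unfolding a1_def P'_def dP_v fst_conv using F by (simp add: ru_def q_def field_simps)
    have t1: "t1 * F x y = dP x y (\<Gamma> x u y) * F x y + C * (- (p * \<rho> + q * ru) + 2 * ru * \<omega> x y) - a1 * F x y
        - q * C * ru - q * (- (p * F x y + q * l x y u) + C * ru)"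
      unfolding t1_def ddP_def a1_def[symmetric] fst_conv l_v r_v dP_self[OF x y] l_self[OF x y]
        A_self[OF x y] using F by (simp add: ru_def q_def field_simps)
    have t2: "t2 * F x y = dP x y (\<Gamma> x u y) * F x y + C * (- (2 * q * ru) + ru * \<omega> x y + \<omega> x u * \<rho>) - a2 * l x y u
        - q * C * ru - p * (- (2 * q * F x y) + C * \<rho>)"
      unfolding t2_def ddP_def a2_def[symmetric] fst_conv vy distrib_right
        times_divide_eq_left nonzero_mult_div_cancel_right[OF F]
      by (simp add: bilinear_r'[OF x] A_neg[OF x] A_scale[OF x] A_self[OF x y]
        l_neg[OF x] l_scale[OF x] l_self[OF x y] r_sym[OF x, of y u] \<Gamma>_sym[OF x, of y u]
        algebra_simps flip: \<rho>_def ru_def p_def q_def)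
    \<comment> \<open>After multiplication by \<open>F\<close>, the terms
      \<open>dP x y (\<Gamma> x u y)\<close> of \<open>t1\<close> and \<open>t2\<close> cancel, and
      the rest is a polynomial identity modulo the relations for \<open>\<rho>\<close>,
      \<open>p\<close> and \<open>a2\<close>.\<close>
    have "(t1 - t2 + a1 - q * p + p * s) * F x y = - (C * (\<omega> x u * \<rho> - \<omega> x y * ru) + \<Xi> x y * l x y u)"
      using t1 t2 a2 \<rho> p unfolding \<Xi>_def q_def[symmetric] s_def by algebra
    then show ?thesis using F by (simp add: \<rho>_def ru_def field_simps)
  qed
  finally show ?thesis by simp
qed

text \<open>By \<open>\<omega>_Rm\<close> the coefficient of \<open>y\<close> is
  \<open>\<tau>\<close>, which cancels the part \<open>l \<otimes> l\<close> of \<open>gF\<close> in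
  the numerator. Only \<open>F * A\<close> is left, and on vectors \<open>h\<close>-orthogonal to
  \<open>y\<close>, such as the Riemannian curvature term, \<open>A\<close> is \<open>h\<close>
  divided by \<alpha>. Numerator and denominator then share the factor \<open>F\<close> over a power
  of \<alpha>.\<close>

lemma flag_curvature_eq:
  assumes x: "x \<in> S" and flag: "flag K y"
  shows "flag_curvature F x K y = (h x y y * sectional_curvature h x K + \<Xi> x y) / (F x y)\<^sup>2"
proof -
  have y: "y \<noteq> 0" using flag by (simp add: flag_def)
  have *: "(h x y y * sectional_curvature h x K + \<Xi> x y) / (F x y)\<^sup>2 =
      fundamental_tensor F x y (chern_curvature F x y u y y) u /
        (fundamental_tensor F x y y y * fundamental_tensor F x y u u - (fundamental_tensor F x y y u)\<^sup>2)"
    if u: "K = span {u, y}" for u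
  proof -
    define D where "D = h x y y * h x u u - (h x y u)\<^sup>2"
    define a where "a = \<alpha> x y"
    define Q where "Q = h x (Rm x u y y) u"
    have dim: "dim (span {u, y}) = 2" using flag u by (simp add: flag_def)
    have sec: "sectional_curvature h x K = Q / D"
      by (simp add: u sectional_curvature_eq[OF x dim] D_def Q_def)
    have D: "D > 0"
      using gram_det_pos[OF pos_definite[OF x] sym[OF x] dim] sym[OF x, of u y] by (simp add: D_def)
    have a: "a > 0" and F: "F x y > 0" using \<alpha>_pos[OF x y] F_pos[OF x y] by (auto simp: a_def)
    have hR: "h x y (Rm x u y y) = 0"
      using h_Rm_self[OF x, of u y y] sym[OF x, of y] by simp
    have lR: "l x y (Rm x u y y) = C * (\<omega> x u * r x y y - \<omega> x y * r x u y)"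
      by (simp add: l_def hR \<omega>_Rm[OF x])
    have AR: "A x y (Rm x u y y) u = Q / a" by (simp add: A_def hR Q_def a_def)
    have Au: "A x y u u = D / a ^ 3" by (simp add: A_gram[OF x y] D_def a_def)
    define \<tau> where "\<tau> = (l x y (Rm x u y y) + \<Xi> x y * l x y u) / F x y"
    have "gF x y (chern_curvature F x y u y y) u = gF x y (Rm x u y y) u + \<Xi> x y * gF x y u u - \<tau> * gF x y y u"
      using bilinear_lsub[OF bilinear_gF[OF x]]
      by (simp add: chern_curvature_eq[OF x y] gF_add[OF x] gF_scale[OF x] \<tau>_def lR)
    also have "\<dots> = F x y * (Q / a + \<Xi> x y * (D / a ^ 3))"
      using F by (simp add: gF_self[OF x y] \<tau>_def) (simp add: gF_def AR Au algebra_simps)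
    finally have num: "gF x y (chern_curvature F x y u y y) u = F x y * (Q / a + \<Xi> x y * (D / a ^ 3))" .
    have den: "gF x y y y * gF x y u u - (gF x y y u)\<^sup>2 = (F x y)\<^sup>2 * (F x y * (D / a ^ 3))"
      by (simp add: gF_self[OF x y] l_self[OF x y]) (simp add: gF_def Au power2_eq_square algebra_simps)
    show ?thesis
      unfolding fundamental_tensor_eq'[OF x y] num den sec \<alpha>_sq[OF x y] a_def[symmetric]
      using a D F by (simp add: field_simps eval_nat_numeral)
  qed
  show ?thesis
    unfolding flag_curvature_def Let_def
  proof (rule the_equality)
    fix k assume "\<forall>u. K = span {u, y} \<longrightarrow> k = fundamental_tensor F x y (chern_curvature F x y u y y) u /
        (fundamental_tensor F x y y y * fundamental_tensor F x y u u - (fundamental_tensor F x y y u)\<^sup>2)"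
    moreover obtain u where "K = span {u, y}" using flag_second_vector[OF flag] .
    ultimately show "k = (h x y y * sectional_curvature h x K + \<Xi> x y) / (F x y)\<^sup>2" using * by simp
  qed (use * in blast)
qed

end

section \<open>Left invariant fields in a chart\<close>

locale lie_group_chart = lie_group G T A
  for G :: "('g, 'm) monoid_scheme" (structure)
    and T :: "'g topology" and A :: "('g, 'e::euclidean_space) chart set" +
  fixes c :: "('g, 'e) chart"
  assumes chart: "c \<in> A" and one_in_chart: "\<one> \<in> fst c"
begin

abbreviation S :: "'e set" where "S \<equiv> coords c"
abbreviation ci :: "'e \<Rightarrow> 'g" where "ci \<equiv> chart_inv c"
abbreviation e0 :: "'e" where "e0 \<equiv> snd c \<one>"
abbreviation B :: "'e \<Rightarrow> 'e \<Rightarrow> 'e" where "B \<equiv> left_field G c"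
abbreviation bracket :: "'e \<Rightarrow> 'e \<Rightarrow> 'e" where "bracket \<equiv> lie_bracket G c"

definition mult_coords :: "'e \<times> 'e \<Rightarrow> 'e" where
  "mult_coords = (\<lambda>(x, y). snd c (ci x \<otimes> ci y))"

definition M :: "('e \<times> 'e) set" where
  "M = {(x, y). x \<in> S \<and> y \<in> S \<and> ci x \<otimes> ci y \<in> fst c}"

abbreviation m' :: "'e \<times> 'e \<Rightarrow> 'e \<times> 'e \<Rightarrow> 'e" where
  "m' q \<equiv> frechet_derivative mult_coords (at q)"

lemma open_S: "open S"
  using chart_coords[OF chart] .

lemma chart_carrier: "p \<in> fst c \<Longrightarrow> p \<in> carrier G"
  using chart_domain[OF chart] openin_subset topspace_carrier by blast

lemma ci_in: "x \<in> S \<Longrightarrow> ci x \<in> fst c"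
  unfolding coords_def chart_inv_def by (rule inv_into_into)

lemma ci_carrier: "x \<in> S \<Longrightarrow> ci x \<in> carrier G"
  by (rule chart_carrier[OF ci_in])

lemma snd_ci: "x \<in> S \<Longrightarrow> snd c (ci x) = x"
  unfolding coords_def chart_inv_def by (rule f_inv_into_f)

lemma topspace_chart: "topspace (subtopology T (fst c)) = fst c"
  using chart_domain[OF chart] openin_subset by (auto simp: topspace_subtopology)

lemma ci_snd: "p \<in> fst c \<Longrightarrow> ci (snd c p) = p"
  using homeomorphic_imp_injective_map[OF chart_homeo[OF chart]] topspace_chart
  unfolding chart_inv_def by (simp add: inv_into_f_f)

lemma snd_in: "p \<in> fst c \<Longrightarrow> snd c p \<in> S"
  by (simp add: coords_def)

lemma e0_in: "e0 \<in> S"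
  by (rule snd_in[OF one_in_chart])

lemma ci_e0: "ci e0 = \<one>"
  by (rule ci_snd[OF one_in_chart])

text \<open>\<open>chart_inv\<close> is made by choice (\<open>inv_into\<close>), so it is first
  identified on \<open>S\<close> with the inverse that the chart homeomorphism provides.\<close>

lemma continuous_ci: "continuous_map (top_of_set S) T ci"
proof -
  obtain f where f: "homeomorphic_maps (subtopology T (fst c)) (top_of_set S) (snd c) f"
    using chart_homeo[OF chart] homeomorphic_map_maps by blast
  then have cont: "continuous_map (top_of_set S) T f"
    and fin: "\<And>x. x \<in> S \<Longrightarrow> f x \<in> fst c" and sf: "\<And>x. x \<in> S \<Longrightarrow> snd c (f x) = x"
    by (auto simp: homeomorphic_maps_def continuous_map_in_subtopology)
  have "f x = ci x" if "x \<in> S" for x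
    using ci_snd[OF fin[OF that]] sf[OF that] by simp
  then show ?thesis
    by (intro continuous_map_eq[OF cont]) auto
qed

lemma open_translate:
  assumes a: "a \<in> carrier G"
  shows "open {y \<in> S. a \<otimes> ci y \<in> fst c}"
proof -
  have "continuous_map (top_of_set S) (prod_topology T T) (\<lambda>y. (a, ci y))"
    using continuous_ci a topspace_carrier by (simp add: continuous_map_pairwise o_def)
  from continuous_map_compose[OF this mult_continuous]
  have "continuous_map (top_of_set S) T (\<lambda>y. a \<otimes> ci y)" by (simp add: o_def)
  from openin_continuous_map_preimage[OF this chart_domain[OF chart]]
  have "openin (top_of_set S) {y \<in> S. a \<otimes> ci y \<in> fst c}" by simp
  then show ?thesis using open_S by (simp add: openin_open_eq)
qed

text \<open>Left translation by a fixed point can be written in the chart only where the product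
  stays in it. Identities in the second factor are differentiated on this set, which is open by
  continuity of multiplication.\<close>

definition slice :: "'e \<Rightarrow> 'e set" where
  "slice x = {y \<in> S. ci x \<otimes> ci y \<in> fst c}"

lemma open_slice: "x \<in> S \<Longrightarrow> open (slice x)"
  unfolding slice_def by (rule open_translate[OF ci_carrier])

lemma in_M: "(x, y) \<in> M \<longleftrightarrow> x \<in> S \<and> y \<in> slice x"
  by (auto simp: M_def slice_def)

lemma e0_slice: "x \<in> S \<Longrightarrow> e0 \<in> slice x"
  using e0_in ci_in by (simp add: slice_def ci_e0 ci_carrier)

lemma M_e0: "x \<in> S \<Longrightarrow> (x, e0) \<in> M"
  by (simp add: in_M e0_slice)

lemma mult_coords_in: "(x, y) \<in> M \<Longrightarrow> mult_coords (x, y) \<in> S"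
  by (auto simp: M_def mult_coords_def intro: snd_in)

lemma ci_mult_coords: "(x, y) \<in> M \<Longrightarrow> ci (mult_coords (x, y)) = ci x \<otimes> ci y"
  by (auto simp: M_def mult_coords_def intro: ci_snd)

lemma mult_coords_e0: "x \<in> S \<Longrightarrow> mult_coords (x, e0) = x" "x \<in> S \<Longrightarrow> mult_coords (e0, x) = x"
  by (simp_all add: mult_coords_def ci_e0 ci_carrier snd_ci)

lemma smooth_mult_coords: "smooth_on M mult_coords"
  using mult_smooth[OF chart chart chart] by (simp add: M_def mult_coords_def)

lemma mult_coords_derivative: "q \<in> M \<Longrightarrow> (mult_coords has_derivative m' q) (at q)"
  using smooth_mult_coords[unfolded smooth_on_def, rule_format, of "Suc 0"]
  by (simp add: frechet_derivative_works)

lemma m'_differentiable: "q \<in> M \<Longrightarrow> (\<lambda>q. m' q v) differentiable (at q)"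
  using smooth_mult_coords[unfolded smooth_on_def, rule_format, of "Suc (Suc 0)"] by (cases v) simp

lemma pair_derivative: "((\<lambda>y. (x, y)) has_derivative (\<lambda>d. (0, d))) (at y)" "((\<lambda>x. (x, y)) has_derivative (\<lambda>d. (d, 0))) (at x)"
  by (auto intro!: derivative_eq_intros)

lemma translate_derivative:
  assumes "(x, y) \<in> M"
  shows "((\<lambda>y. mult_coords (x, y)) has_derivative (\<lambda>v. m' (x, y) (0, v))) (at y)"
  by (rule has_derivative_compose[OF pair_derivative(1) mult_coords_derivative[OF assms]])

lemma m'_slice_differentiable:
  assumes "(x, y) \<in> M"
  shows "(\<lambda>y. m' (x, y) v) differentiable (at y)" "(\<lambda>x. m' (x, y) v) differentiable (at x)"
  using m'_differentiable[OF assms, of v] has_derivative_compose[OF pair_derivative(1)]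
    has_derivative_compose[OF pair_derivative(2)]
  unfolding differentiable_def by blast+

lemma linear_m': "q \<in> M \<Longrightarrow> linear (m' q)"
  by (rule has_derivative_linear[OF mult_coords_derivative])

lemma linear_m'_snd: "q \<in> M \<Longrightarrow> linear (\<lambda>v. m' q (0, v))"
  using linear_m' linear_compose[of "Pair 0" "m' q"] by (auto simp: o_def linear_iff)

lemma left_field_eq: "x \<in> S \<Longrightarrow> B v x = m' (x, e0) (0, v)"
  using translate_derivative[OF M_e0, of x]
  by (simp add: left_field_def differential_def mult_coords_def frechet_derivative_eqI)

lemma left_field_e0: "B v e0 = v"
proof -
  have "((\<lambda>y. mult_coords (e0, y)) has_derivative (\<lambda>v. v)) (at e0)"
    by (rule has_derivative_cong_open[OF has_derivative_ident open_S e0_in]) (simp add: mult_coords_e0)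
  from has_derivative_unique[OF translate_derivative[OF M_e0[OF e0_in]] this]
  show ?thesis by (simp add: left_field_eq[OF e0_in] fun_eq_iff)
qed

lemma linear_left_field: "x \<in> S \<Longrightarrow> linear (\<lambda>v. B v x)"
  using linear_m'_snd[OF M_e0, of x] by (simp add: left_field_eq)

lemma left_field_derivative:
  assumes x: "x \<in> S"
  shows "(B v has_derivative frechet_derivative (B v) (at x)) (at x)"
  unfolding frechet_derivative_works[symmetric]
  by (rule differentiable_cong_open[OF m'_slice_differentiable(2)[OF M_e0[OF x]] open_S x])
    (simp add: left_field_eq)

text \<open>Differentiate \<open>(x y) t = x (y t)\<close> in \<open>t\<close> at the identity.\<close>

lemma left_field_invariant:
  assumes xy: "(x, y) \<in> M"
  shows "B v (mult_coords (x, y)) = m' (x, y) (0, B v y)"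
proof -
  have S: "x \<in> S" "y \<in> S" "mult_coords (x, y) \<in> S"
    using xy mult_coords_in by (auto simp: M_def)
  have eq: "mult_coords (x, mult_coords (y, t)) = mult_coords (mult_coords (x, y), t)" if "t \<in> slice y" for t
  proof -
    have t: "(y, t) \<in> M" "t \<in> S" using that S by (auto simp: in_M slice_def)
    show ?thesis
      using ci_mult_coords[OF t(1)] ci_mult_coords[OF xy] ci_carrier[OF S(1)] ci_carrier[OF S(2)] ci_carrier[OF t(2)]
      by (simp add: mult_coords_def m_assoc)
  qed
  have "((\<lambda>t. mult_coords (x, mult_coords (y, t))) has_derivative (\<lambda>v. m' (x, y) (0, m' (y, e0) (0, v)))) (at e0)"
    by (rule has_derivative_compose[OF translate_derivative[OF M_e0[OF S(2)]], of "\<lambda>y. mult_coords (x, y)"])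
      (simp add: mult_coords_e0 S translate_derivative[OF xy])
  then have "((\<lambda>t. mult_coords (mult_coords (x, y), t)) has_derivative (\<lambda>v. m' (x, y) (0, m' (y, e0) (0, v)))) (at e0)"
    by (rule has_derivative_cong_open[OF _ open_slice[OF S(2)] e0_slice[OF S(2)]]) (rule eq)
  from has_derivative_unique[OF translate_derivative[OF M_e0[OF S(3)]] this]
  show ?thesis by (simp add: left_field_eq S fun_eq_iff)
qed

section \<open>Brackets and covariant derivatives of left invariant fields\<close>

abbreviation DB :: "'e \<Rightarrow> 'e \<Rightarrow> 'e \<Rightarrow> 'e" where
  "DB v x \<equiv> frechet_derivative (B v) (at x)"

lemma linear_DB: "x \<in> S \<Longrightarrow> linear (DB v x)"
  by (rule has_derivative_linear[OF left_field_derivative])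

lemma linear_DB_left: "x \<in> S \<Longrightarrow> linear (\<lambda>v. DB v x u)"
proof (rule linearI)
  assume x: "x \<in> S"
  fix v w and k :: real
  have "DB (v + w) x = (\<lambda>u. DB v x u + DB w x u)"
    by (rule frechet_derivative_eqI, rule has_derivative_cong_open[OF has_derivative_add[OF
        left_field_derivative[OF x] left_field_derivative[OF x]] open_S x])
      (simp add: linear_add[OF linear_left_field])
  then show "DB (v + w) x u = DB v x u + DB w x u" by simp
  have "DB (k *\<^sub>R v) x = (\<lambda>u. k *\<^sub>R DB v x u)"
    by (rule frechet_derivative_eqI, rule has_derivative_cong_open[OF has_derivative_scaleR_right[OF
        left_field_derivative[OF x]] open_S x])
      (simp add: linear_cmul[OF linear_left_field])
  then show "DB (k *\<^sub>R v) x u = k *\<^sub>R DB v x u" by simp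
qed

lemma bracket_eq: "bracket v w = DB w e0 v - DB v e0 w"
  by (simp add: lie_bracket_def vf_bracket_def left_field_e0)

lemma bilinear_bracket: "bilinear bracket"
  unfolding bilinear_def bracket_eq[abs_def]
  by (intro conjI allI linear_compose_sub linear_DB linear_DB_left e0_in)

lemma bracket_antisym: "bracket v w = - bracket w v"
  by (simp add: bracket_eq)

text \<open>Differentiating \<open>B v (x t) = L\<^sub>x' (B v t)\<close> in \<open>t\<close> at the identity, where \<open>L\<^sub>x\<close> is the left
  translation; the second derivative of \<open>L\<^sub>x\<close> drops out of the bracket by symmetry.\<close>

lemma left_field_bracket:
  assumes x: "x \<in> S"
  shows "DB w x (B v x) - DB v x (B w x) = B (bracket v w) x"
proof -
  define L2 where "L2 u = frechet_derivative (\<lambda>t. m' (x, t) (0, u)) (at e0)" for u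
  have L2: "((\<lambda>t. m' (x, t) (0, u)) has_derivative L2 u) (at e0)" for u
    unfolding L2_def frechet_derivative_works[symmetric]
    by (rule m'_slice_differentiable(1)[OF M_e0[OF x]])
  have slice: "open (slice x)" "e0 \<in> slice x" using open_slice e0_slice x by auto
  have L2_sym: "L2 u w = L2 w u" for u w
    by (rule symmetric_second_derivative[where f = "\<lambda>t. mult_coords (x, t)" and S = "slice x" and ?x0.0 = e0
        and f' = "\<lambda>t u. m' (x, t) (0, u)", OF slice _ L2 L2])
      (use x in \<open>auto intro!: translate_derivative simp: in_M\<close>)
  have DB: "DB v x (B w x) = L2 v w + B (DB v e0 w) x" for v w
  proof -
    have "((\<lambda>t. m' (x, t) (0, B v t)) has_derivative
        (\<lambda>w. L2 (B v e0) w + m' (x, e0) (0, DB v e0 w))) (at e0)"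
      by (rule linear_family_has_derivative[where L = "\<lambda>t u. m' (x, t) (0, u)" and L' = "\<lambda>w u. L2 u w",
          OF slice linear_m'_snd L2 left_field_derivative[OF e0_in]]) (simp add: in_M x)
    then have 1: "((\<lambda>t. B v (mult_coords (x, t))) has_derivative
        (\<lambda>w. L2 v w + m' (x, e0) (0, DB v e0 w))) (at e0)"
      unfolding left_field_e0
      by (rule has_derivative_cong_open[OF _ slice]) (simp add: left_field_invariant in_M x)
    have "((\<lambda>t. B v (mult_coords (x, t))) has_derivative (\<lambda>w. DB v x (m' (x, e0) (0, w)))) (at e0)"
      by (rule has_derivative_compose[OF translate_derivative[OF M_e0[OF x]], of "B v"])
        (simp add: mult_coords_e0 x left_field_derivative)
    from has_derivative_unique[OF 1 this] show ?thesis
      by (simp add: left_field_eq[OF x] fun_eq_iff)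
  qed
  show ?thesis
    using L2_sym[of v w] by (simp add: DB bracket_eq linear_diff[OF linear_left_field[OF x]])
qed

lemma left_invariant_metric_left_field:
  assumes "left_invariant_metric G A g" and x: "x \<in> S"
  shows "g c x (B v x) (B w x) = g c e0 v w"
  using assms(1)[unfolded left_invariant_metric_def, rule_format, OF ci_carrier[OF x] chart chart one_in_chart, of v w]
  by (simp add: left_field_def ci_carrier ci_in snd_ci x)

lemma left_invariant_vfield_eq:
  assumes "left_invariant_vfield G A X" and x: "x \<in> S"
  shows "X c x = B (X c e0) x"
  using assms(1)[unfolded left_invariant_vfield_def, rule_format, OF ci_carrier[OF x] chart chart one_in_chart]
  by (simp add: left_field_def ci_carrier ci_in snd_ci x)

lemma riemannian_domain_chart:
  assumes "riemannian_metric A g" shows "riemannian_domain S (g c)"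
  using assms chart open_S
  by unfold_locales (auto simp: riemannian_metric_def pos_definite_def)

text \<open>Inner products of left invariant fields are constant, so the derivative terms of the
  general Koszul formula vanish. Compatibility makes \<open>V\<close> skew in its last two
  arguments, vanishing torsion measures its asymmetry in the first two by the bracket, and three
  instances of each isolate \<open>V u v w\<close>.\<close>

lemma koszul:
  assumes g: "riemannian_metric A g" "left_invariant_metric G A g" and x: "x \<in> S"
  shows "2 * g c x (DB v x (B u x) + levi_civita (g c) x (B u x) (B v x)) (B w x)
    = g c e0 (bracket u v) w - g c e0 (bracket v w) u + g c e0 (bracket w u) v"
proof -
  interpret R: riemannian_domain S "g c" by (rule riemannian_domain_chart[OF g(1)])
  define V where "V u v w = g c x (DB v x (B u x) + levi_civita (g c) x (B u x) (B v x)) (B w x)" for u v w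
  have metric: "V u v w = - V u w v" for u v w
  proof -
    have "((\<lambda>x. g c x (B v x) (B w x)) has_derivative
      (\<lambda>d. g c x (DB v x d + levi_civita (g c) x d (B v x)) (B w x)
         + g c x (B v x) (DB w x d + levi_civita (g c) x d (B w x)))) (at x)"
      by (rule R.h_covariant_derivative[where p = "\<lambda>x. x", OF x has_derivative_ident
          left_field_derivative[OF x] left_field_derivative[OF x]])
    moreover have "((\<lambda>x. g c x (B v x) (B w x)) has_derivative (\<lambda>d. 0)) (at x)"
      by (rule has_derivative_cong_open[OF has_derivative_const open_S x])
        (simp add: left_invariant_metric_left_field[OF g(2)])
    ultimately have "(\<lambda>d. g c x (DB v x d + levi_civita (g c) x d (B v x)) (B w x)
         + g c x (B v x) (DB w x d + levi_civita (g c) x d (B w x))) = (\<lambda>d. 0)"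
      by (rule has_derivative_unique)
    from fun_cong[OF this, of "B u x"] show ?thesis
      using R.sym[OF x, of "B v x"] by (simp add: V_def)
  qed
  have torsion: "V u v w = g c e0 (bracket u v) w + V v u w" for u v w
  proof -
    have "g c e0 (bracket u v) w = g c x (DB v x (B u x) - DB u x (B v x)) (B w x)"
      by (simp add: left_field_bracket[OF x] left_invariant_metric_left_field[OF g(2) x])
    then show ?thesis
      by (simp add: V_def R.h_add[OF x] R.h_sub[OF x] R.\<Gamma>_sym[OF x, of "B v x" "B u x"])
  qed
  show ?thesis
    using torsion[of u v w] metric[of v u w] torsion[of v w u] metric[of w v u] torsion[of w u v] metric[of u w v]
    unfolding V_def[symmetric] by linarith
qed

end

lemma cauchy_schwarz_pos_definite:
  assumes B: "pos_definite B" and sym: "\<And>v w. B v w = (B w v :: real)"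
  shows "\<bar>B u w\<bar> \<le> sqrt (B u u) * sqrt (B w w)"
proof -
  have "(B u w)\<^sup>2 \<le> B u u * B w w" using gram_det_nonneg[OF B sym, of w u] by (simp add: mult.commute)
  then have "sqrt ((B u w)\<^sup>2) \<le> sqrt (B u u * B w w)" by (rule real_sqrt_le_mono)
  then show ?thesis by (simp add: real_sqrt_mult)
qed

lemma codim_one_decomposition:
  fixes b :: "'e::euclidean_space"
  assumes "subspace U" "dim U + 1 = DIM('e)" "b \<notin> U"
  obtains \<zeta> v where "v \<in> U" "z = \<zeta> *\<^sub>R b + v"
proof -
  have U: "span U = U" using assms(1) by (simp only: span_eq_iff)
  then have "b \<notin> span U" using assms(3) by (simp only: not_False_eq_True)
  then have "dim (insert b U) = DIM('e)" using assms(2) by (simp add: dim_insert)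
  then have "z \<in> span (insert b U)" using dim_eq_full by blast
  then obtain \<zeta> where "z - \<zeta> *\<^sub>R b \<in> U" unfolding span_insert U by blast
  then show thesis using that[of "z - \<zeta> *\<^sub>R b" \<zeta>] by simp
qed

theorem theorem4p5:
  fixes G :: "('g, 'm) monoid_scheme"
    and T :: "'g topology"
    and A :: "('g, 'e::euclidean_space) chart set"
    and c :: "('g, 'e) chart"
    and g :: "('g, 'e) metric_field"
    and X :: "('g, 'e) vfield"
    and b :: 'e and \<uu> :: "'e set" and \<xi> :: real
  assumes "lie_group G T A"
    and "c \<in> A" and "\<one>\<^bsub>G\<^esub> \<in> fst c"
    and "class_G1 G c"
    and "riemannian_metric A g" and "left_invariant_metric G A g"
    and "vector_field A X" and "left_invariant_vfield G A X"
    and "\<And>d x. d \<in> A \<Longrightarrow> x \<in> coords d \<Longrightarrow> sqrt (g d x (X d x) (X d x)) < 1"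
    and "douglas_type A (randers g X)"
    and "commutative_ideal G c \<uu>" and "dim \<uu> + 1 = DIM('e)"
    and "\<And>z. z \<in> \<uu> \<Longrightarrow> lie_bracket G c b z = z"
    and "\<And>z. z \<in> \<uu> \<Longrightarrow> g c (snd c \<one>\<^bsub>G\<^esub>) b z = 0"
    and "X c (snd c \<one>\<^bsub>G\<^esub>) = \<xi> *\<^sub>R b"
  shows "\<forall>P y \<eta> v. flag P y \<and> v \<in> \<uu> \<and> y = \<eta> *\<^sub>R b + v \<longrightarrow>
    (let g\<^sub>0 = g c (snd c \<one>\<^bsub>G\<^esub>); F = randers g X c (snd c \<one>\<^bsub>G\<^esub>) y;
         K\<^sub>F = flag_curvature (randers g X c) (snd c \<one>\<^bsub>G\<^esub>) P y;
         K\<^sub>g = sectional_curvature (g c) (snd c \<one>\<^bsub>G\<^esub>) P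
     in K\<^sub>F = g\<^sub>0 y y / F\<^sup>2 * K\<^sub>g
              + 1 / (4 * F ^ 4) * (3 * \<xi>\<^sup>2 * (g\<^sub>0 v v)\<^sup>2 + 4 * F * \<xi> * \<eta> * g\<^sub>0 v v)
      \<and> (y \<in> span {b} \<longrightarrow> K\<^sub>F = g\<^sub>0 y y / F\<^sup>2 * K\<^sub>g)
      \<and> (y \<in> \<uu> \<longrightarrow> K\<^sub>F = g\<^sub>0 y y / F\<^sup>2 * K\<^sub>g + 3 / (4 * F ^ 4) * \<xi>\<^sup>2 * (g\<^sub>0 v v)\<^sup>2))"
proof (intro allI impI, elim conjE)
  fix K :: "'e set" and y \<eta> v
  assume flag: "flag K y" and v: "v \<in> \<uu>" and y: "y = \<eta> *\<^sub>R b + v"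
  interpret lie_group_chart G T A c
    using assms(1-3) by (simp add: lie_group_chart_def lie_group_chart_axioms_def)
  interpret R: riemannian_domain S "g c" by (rule riemannian_domain_chart[OF assms(5)])
  let ?g = "g c e0"
  have \<uu>: "subspace \<uu>" and abelian: "\<And>z w. z \<in> \<uu> \<Longrightarrow> w \<in> \<uu> \<Longrightarrow> bracket z w = 0"
    using assms(11) by (auto simp: commutative_ideal_def)
  note perp = assms(14)
  \<comment> \<open>If \<open>b = 0\<close>, then \<open>[b, z] = z\<close> forces \<uu> to be
    trivial, and the algebra would be one-dimensional, too small for a flag.\<close>
  have b: "b \<noteq> 0"
  proof
    assume "b = 0"
    then have "\<uu> \<subseteq> {0}" using assms(13) bilinear_lzero[OF bilinear_bracket] by auto
    then have "dim \<uu> = 0" by (simp only: dim_eq_0)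
    then have "DIM('e) = 1" using assms(12) by linarith
    then show False using flag dim_subset_UNIV[of K] by (simp add: flag_def)
  qed
  define \<beta> where "\<beta> = ?g b b"
  have \<beta>: "\<beta> > 0" using R.pos_definite[OF e0_in] b by (simp add: \<beta>_def pos_definite_def)
  have b_notin: "b \<notin> \<uu>" using perp[of b] \<beta> by (auto simp: \<beta>_def)
  define \<omega> where "\<omega> x w = g c x (B b x) w / \<beta>" for x w
  have nabla_b: "g c x (DB b x u + levi_civita (g c) x u (B b x)) w = \<beta> * (\<omega> x u * \<omega> x w) - g c x u w"
    if x: "x \<in> S" for x u w
  proof -
    \<comment> \<open>Left translation preserves the metric and is therefore injective on tangent
      vectors, hence bijective; so arbitrary vectors at \<open>x\<close> are values of left
      invariant fields, to which \<open>koszul\<close> applies.\<close>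
    have "inj (\<lambda>z. B z x)"
    proof (rule linear_injective_0[OF linear_left_field[OF x], THEN iffD2], intro allI impI)
      fix z assume "B z x = 0"
      then have "?g z z = 0"
        using left_invariant_metric_left_field[OF assms(6) x, of z z] by (simp add: bilinear_lzero[OF R.bilinear_h[OF x]])
      then show "z = 0" using R.pos_definite[OF e0_in] by (metis less_irrefl pos_definite_def)
    qed
    from linear_injective_imp_surjective[OF linear_left_field[OF x] this]
    have "surj (\<lambda>z. B z x)" by simp
    then obtain p q where p: "u = B p x" and q: "w = B q x" by (metis surjD)
    obtain \<zeta> z where z: "z \<in> \<uu>" "p = \<zeta> *\<^sub>R b + z"
      using codim_one_decomposition[OF \<uu> assms(12) b_notin] .
    obtain \<theta> t where t: "t \<in> \<uu>" "q = \<theta> *\<^sub>R b + t"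
      using codim_one_decomposition[OF \<uu> assms(12) b_notin] .
    have bb: "bracket b b = 0" by (simp add: bracket_eq)
    have zb: "bracket z b = - z" "bracket t b = - t"
      using bracket_antisym[of _ b] assms(13) z(1) t(1) by auto
    note bil = bilinear_ladd[OF bilinear_bracket] bilinear_radd[OF bilinear_bracket]
      bilinear_lmul[OF bilinear_bracket] bilinear_rmul[OF bilinear_bracket]
    have br: "bracket p b = - z" "bracket b q = t" "bracket q p = \<theta> *\<^sub>R z - \<zeta> *\<^sub>R t"
      using assms(13)[OF z(1)] assms(13)[OF t(1)] abelian[OF t(1) z(1)]
      by (simp_all add: z t bil bb zb)
    note S = left_invariant_metric_left_field[OF assms(6) x] R.h_add[OF e0_in] R.h_scale[OF e0_in]
      R.h_sub[OF e0_in] R.h_neg[OF e0_in] perp z(1) t(1) R.sym[OF e0_in, of z b] R.sym[OF e0_in, of t b]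
    \<comment> \<open>The brackets \<open>[p, b] = - z\<close> and \<open>[b, q] = t\<close>
      contribute \<open>- ?g z t\<close> each, and \<open>[q, p]\<close> lies in \<uu>, orthogonal
      to \<open>b\<close>. So the covariant derivative of \<open>B b\<close> along \<open>u\<close>
      is minus the \<uu>-part of \<open>u\<close>.\<close>
    have "2 * g c x (DB b x u + levi_civita (g c) x u (B b x)) w = - 2 * ?g z t"
      unfolding p q koszul[OF assms(5,6) x] br unfolding z(2) t(2)
      using R.sym[OF e0_in, of t z] by (simp add: S)
    moreover have "\<omega> x u = \<zeta>" "\<omega> x w = \<theta>"
      using \<beta> by (simp_all add: \<omega>_def p q z(2) t(2) S flip: \<beta>_def)
    moreover have "g c x u w = \<zeta> * \<theta> * \<beta> + ?g z t"
      by (simp add: p q z(2) t(2) S \<beta>_def)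
    ultimately show ?thesis by simp
  qed
  have X: "X c x = \<xi> *\<^sub>R B b x" if "x \<in> S" for x
    using left_invariant_vfield_eq[OF assms(8) that] assms(15) linear_cmul[OF linear_left_field[OF that]] by simp
  have X\<omega>: "g c x (X c x) w = \<xi> * \<beta> * \<omega> x w" if "x \<in> S" for x w
    using \<beta> by (simp add: X[OF that] \<omega>_def R.h_scale[OF that])
  \<comment> \<open>The constant is \<open>\<xi> * \<beta>\<close> because \<omega> was normalized
    by \<open>1 / \<beta>\<close>; the bound on the one-form is Cauchy-Schwarz together with
    \<open>X\<close> having length below 1.\<close>
  interpret F: randers_domain S "g c" \<omega> \<beta> "\<xi> * \<beta>" "randers g X c"
  proof (intro randers_domain.intro randers_domain_axioms.intro R.riemannian_domain_axioms)
    show "\<beta> \<noteq> 0" using \<beta> by simp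
    fix x w z assume x: "x \<in> S"
    show "linear (\<omega> x)"
      by (rule linearI) (simp_all add: \<omega>_def R.h_add[OF x] R.h_scale[OF x] add_divide_distrib)
    have "((\<lambda>x. g c x (B b x) w) has_derivative
        (\<lambda>d. g c x (DB b x d + levi_civita (g c) x d (B b x)) w + g c x (B b x) (0 + levi_civita (g c) x d w))) (at x)"
      by (rule R.h_covariant_derivative[where p = "\<lambda>x. x", OF x has_derivative_ident
          left_field_derivative[OF x] has_derivative_const])
    from has_derivative_mult_right[OF this, of "1 / \<beta>"]
    show "((\<lambda>x. \<omega> x w) has_derivative
          (\<lambda>u. \<omega> x u * \<omega> x w - g c x u w / \<beta> + \<omega> x (levi_civita (g c) x u w))) (at x)"
      unfolding \<omega>_def[of _ w] \<omega>_def[of x "levi_civita _ _ _ _"] nabla_b[OF x]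
      using \<beta> by (simp add: \<omega>_def[of x] field_simps)
    show "randers g X c x z = sqrt (g c x z z) + \<xi> * \<beta> * \<omega> x z"
      by (simp add: randers_def X\<omega>[OF x])
    assume "z \<noteq> 0"
    then have "sqrt (g c x z z) > 0" using R.pos_definite[OF x] by (simp add: pos_definite_def)
    then have "sqrt (g c x (X c x) (X c x)) * sqrt (g c x z z) < 1 * sqrt (g c x z z)"
      using assms(9)[OF chart x] by (intro mult_strict_right_mono)
    then show "\<bar>\<xi> * \<beta> * \<omega> x z\<bar> < sqrt (g c x z z)"
      using cauchy_schwarz_pos_definite[OF R.pos_definite[OF x] R.sym[OF x], of "X c x" z] X\<omega>[OF x] by simp
  qed
  define N where "N = randers g X c e0 y"
  define k where "k = sectional_curvature (g c) e0 K"
  have y0: "y \<noteq> 0" using flag by (simp add: flag_def)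
  have N: "N > 0" unfolding N_def by (rule F.F_pos[OF e0_in y0])
  have \<omega>y: "\<omega> e0 y = \<eta>"
    using \<beta> by (simp add: \<omega>_def left_field_e0 y R.h_add[OF e0_in] R.h_scale[OF e0_in] perp[OF v] flip: \<beta>_def)
  have gy: "?g y y = \<eta>\<^sup>2 * \<beta> + ?g v v"
    by (simp add: y R.h_add[OF e0_in] R.h_scale[OF e0_in] perp[OF v] R.sym[OF e0_in, of v b] \<beta>_def power2_eq_square)
  \<comment> \<open>In \<open>F.r\<close> the terms with \<open>\<eta>\<^sup>2\<close> cancel,
    leaving \<open>- ?g v v / \<beta>\<close>; the factor \<open>\<xi> * \<beta>\<close> then
    removes \<beta> from the result.\<close>
  have P: "F.P e0 y = - \<xi> * ?g v v / (2 * N)"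
    unfolding F.P_def F.r_def \<omega>y gy N_def using \<beta> by (simp add: power2_eq_square field_simps)
  have \<Xi>: "F.\<Xi> e0 y = 3 * \<xi>\<^sup>2 * (?g v v)\<^sup>2 / (4 * N\<^sup>2) + \<xi> * \<eta> * ?g v v / N"
    unfolding F.\<Xi>_def \<omega>y P using N by (simp add: power2_eq_square field_simps)
  have main: "flag_curvature (randers g X c) e0 K y = ?g y y / N\<^sup>2 * k
      + 1 / (4 * N ^ 4) * (3 * \<xi>\<^sup>2 * (?g v v)\<^sup>2 + 4 * N * \<xi> * \<eta> * ?g v v)"
    unfolding F.flag_curvature_eq[OF e0_in flag] \<Xi> N_def[symmetric] k_def[symmetric]
    using N by (simp add: field_simps eval_nat_numeral)
  \<comment> \<open>The two special cases amount to \<eta> = 0 and \<open>v = 0\<close>, by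
    uniqueness of the splitting along \<open>b\<close> and \<uu>.\<close>
  have in_\<uu>: "\<eta> = 0" if "y \<in> \<uu>"
  proof (rule ccontr)
    assume "\<eta> \<noteq> 0"
    moreover have "\<eta> *\<^sub>R b \<in> \<uu>" using subspace_diff[OF \<uu> that v] by (simp add: y)
    ultimately have "b \<in> \<uu>" using subspace_scale[OF \<uu>, of "\<eta> *\<^sub>R b" "1 / \<eta>"] by simp
    then show False using b_notin by simp
  qed
  have in_b: "v = 0" if yb: "y \<in> span {b}"
  proof -
    obtain s where "y = s *\<^sub>R b" using yb by (auto simp: span_singleton)
    then have "v = (s - \<eta>) *\<^sub>R b" using y by (simp add: algebra_simps)
    then have "?g v v = 0" using perp[OF v] by (simp add: R.h_scale[OF e0_in])
    then show ?thesis using R.pos_definite[OF e0_in] by (metis less_irrefl pos_definite_def)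
  qed
  show "let g\<^sub>0 = ?g; F = randers g X c e0 y; K\<^sub>F = flag_curvature (randers g X c) e0 K y;
         K\<^sub>g = sectional_curvature (g c) e0 K
     in K\<^sub>F = g\<^sub>0 y y / F\<^sup>2 * K\<^sub>g
              + 1 / (4 * F ^ 4) * (3 * \<xi>\<^sup>2 * (g\<^sub>0 v v)\<^sup>2 + 4 * F * \<xi> * \<eta> * g\<^sub>0 v v)
      \<and> (y \<in> span {b} \<longrightarrow> K\<^sub>F = g\<^sub>0 y y / F\<^sup>2 * K\<^sub>g)
      \<and> (y \<in> \<uu> \<longrightarrow> K\<^sub>F = g\<^sub>0 y y / F\<^sup>2 * K\<^sub>g + 3 / (4 * F ^ 4) * \<xi>\<^sup>2 * (g\<^sub>0 v v)\<^sup>2)"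
    unfolding Let_def N_def[symmetric] k_def[symmetric] main
    using in_\<uu> in_b bilinear_lzero[OF R.bilinear_h[OF e0_in]] by auto
qed

end
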